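(* For every positive integer $n$, there is a bijection between $(\mathcal{NG}\text{-}3)_n$ and $\mathcal{U}_{n-4}$.
   Context: All graphs are finite, simple and unlabeled (considered up to isomorphism). For a class $\mathcal{C}$, $\mathcal{C}_k$ denotes the set of graphs in $\mathcal{C}$ with $k$ vertices (empty if $k<0$). $\chi,\omega,\alpha$ are chromatic, clique and independence numbers; $\overline{G}$ is the complement. $G$ is an NG-graph if $\chi(G)+\chi(\overline{G})=|V(G)|+1$; its ABC-partition is $A=\{v:\deg(v)=\chi(G)-1\}$, $B=\{v:\deg(v)>\chi(G)-1\}$, $C=\{v:\deg(v)<\chi(G)-1\}$. $\mathcal{NG}\text{-}3$ is the set of NG-graphs with $G[A]$ a 5-cycle. A split graph is one whose vertex set partitions as $K\cup S$ with $K$ a clique and $S$ a stable set; it is balanced if some such partition has $|K|=\omega(G)$ and $|S|=\alpha(G)$ and unbalanced otherwise. $\mathcal{U}$ is the set of unbalanced split graphs. *)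

theory Defs
  imports "Graph_Theory.Pair_Digraph" "Graph_Theory.Digraph_Isomorphism"
begin

text \<open>A finite simple graph is a \<open>pair_graph\<close>: a finite vertex set \<open>pverts\<close> with a symmetric
  irreflexive relation \<open>parcs\<close>, each edge being present as both of its orientations. In particular
  the out-degree of a vertex is its degree.\<close>

definition is_clique :: "'a pair_pre_digraph \<Rightarrow> 'a set \<Rightarrow> bool" where
  "is_clique G K \<longleftrightarrow> K \<subseteq> pverts G \<and> (\<forall>u\<in>K. \<forall>v\<in>K. u \<noteq> v \<longrightarrow> (u, v) \<in> parcs G)"

definition is_stable :: "'a pair_pre_digraph \<Rightarrow> 'a set \<Rightarrow> bool" where
  "is_stable G S \<longleftrightarrow> S \<subseteq> pverts G \<and> (\<forall>u\<in>S. \<forall>v\<in>S. (u, v) \<notin> parcs G)"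

definition clique_number :: "'a pair_pre_digraph \<Rightarrow> nat" where
  "clique_number G = Max {card K | K. is_clique G K}"

definition independence_number :: "'a pair_pre_digraph \<Rightarrow> nat" where
  "independence_number G = Max {card S | S. is_stable G S}"

definition proper_colouring :: "'a pair_pre_digraph \<Rightarrow> nat \<Rightarrow> ('a \<Rightarrow> nat) \<Rightarrow> bool" where
  "proper_colouring G k c \<longleftrightarrow> c ` pverts G \<subseteq> {..<k} \<and> (\<forall>(u, v)\<in>parcs G. c u \<noteq> c v)"

definition chromatic_number :: "'a pair_pre_digraph \<Rightarrow> nat" where
  "chromatic_number G = (LEAST k. \<exists>c. proper_colouring G k c)"

definition graph_complement :: "'a pair_pre_digraph \<Rightarrow> 'a pair_pre_digraph" where
  "graph_complement G =
     \<lparr> pverts = pverts G,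
       parcs = {(u, v). u \<in> pverts G \<and> v \<in> pverts G \<and> u \<noteq> v \<and> (u, v) \<notin> parcs G} \<rparr>"

definition cycle_graph :: "nat \<Rightarrow> nat pair_pre_digraph" where
  "cycle_graph m =
     \<lparr> pverts = {..<m},
       parcs = {(i, j). i < m \<and> j < m \<and> (j = Suc i mod m \<or> i = Suc j mod m)} \<rparr>"

definition NG_graph :: "'a pair_pre_digraph \<Rightarrow> bool" where
  "NG_graph G \<longleftrightarrow> pair_graph G \<and>
     chromatic_number G + chromatic_number (graph_complement G) = card (pverts G) + 1"

text \<open>The parts of the ABC-partition. The comparison is made in the integers so that
  \<open>\<chi>(G) - 1\<close> is not truncated.\<close>

definition A_part :: "'a pair_pre_digraph \<Rightarrow> 'a set" where
  "A_part G = {v \<in> pverts G. int (out_degree (with_proj G) v) = int (chromatic_number G) - 1}"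

definition B_part :: "'a pair_pre_digraph \<Rightarrow> 'a set" where
  "B_part G = {v \<in> pverts G. int (out_degree (with_proj G) v) > int (chromatic_number G) - 1}"

definition C_part :: "'a pair_pre_digraph \<Rightarrow> 'a set" where
  "C_part G = {v \<in> pverts G. int (out_degree (with_proj G) v) < int (chromatic_number G) - 1}"

definition NG_3 :: "'a pair_pre_digraph set" where
  "NG_3 = {G. NG_graph G \<and> digraph_iso (with_proj G \<restriction> A_part G) (with_proj (cycle_graph 5))}"

definition split_partition :: "'a pair_pre_digraph \<Rightarrow> 'a set \<Rightarrow> 'a set \<Rightarrow> bool" where
  "split_partition G K S \<longleftrightarrow>
     K \<union> S = pverts G \<and> K \<inter> S = {} \<and> is_clique G K \<and> is_stable G S"

definition split_graph :: "'a pair_pre_digraph \<Rightarrow> bool" where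
  "split_graph G \<longleftrightarrow> pair_graph G \<and> (\<exists>K S. split_partition G K S)"

definition balanced_split_graph :: "'a pair_pre_digraph \<Rightarrow> bool" where
  "balanced_split_graph G \<longleftrightarrow> split_graph G \<and>
     (\<exists>K S. split_partition G K S \<and> card K = clique_number G \<and> card S = independence_number G)"

definition unbalanced_split_graphs :: "'a pair_pre_digraph set" where
  "unbalanced_split_graphs = {G. split_graph G \<and> \<not> balanced_split_graph G}"

text \<open>An unlabeled graph is an isomorphism class of graphs. Every finite graph is isomorphic
  to one whose vertices are natural numbers, so \<^typ>\<open>nat\<close> is taken as the type of vertices.
  The relation below is on all finite simple graphs, so that the members of the quotient are
  complete isomorphism classes.\<close>

definition graph_iso_rel :: "nat pair_pre_digraph rel" where
  "graph_iso_rel =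
     {(G, H). pair_graph G \<and> pair_graph H \<and> digraph_iso (with_proj G) (with_proj H)}"

text \<open>The order \<open>k\<close> is an integer, so the class is empty for negative \<open>k\<close>.\<close>

definition unlabeled_of_order ::
    "nat pair_pre_digraph set \<Rightarrow> int \<Rightarrow> nat pair_pre_digraph set set" where
  "unlabeled_of_order \<C> k = {G \<in> \<C>. int (card (pverts G)) = k} // graph_iso_rel"

lemma digraph_iso_with_proj_iff:
  assumes "pair_wf_digraph G"
  shows "digraph_iso (with_proj G) (with_proj H) \<longleftrightarrow>
    (\<exists>f. inj_on f (pverts G) \<and> pverts H = f ` pverts G \<and>
         parcs H = (\<lambda>(u, v). (f u, f v)) ` parcs G)" (is "?L \<longleftrightarrow> ?R")
proof
  assume ?L
  then obtain h where h: "pre_digraph.digraph_isomorphism (with_proj G) h"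
    and H: "with_proj H = app_iso h (with_proj G)"
    unfolding digraph_iso_def by blast
  have V: "pverts H = iso_verts h ` pverts G" and E: "parcs H = iso_arcs h ` parcs G"
    and t: "iso_tail h = fst" and d: "iso_head h = snd"
    using arg_cong[OF H, of verts] arg_cong[OF H, of arcs]
      arg_cong[OF H, of tail] arg_cong[OF H, of head] by auto
  have arc: "iso_arcs h e = (case e of (u, v) \<Rightarrow> (iso_verts h u, iso_verts h v))"
    if "e \<in> parcs G" for e
    using h that unfolding pre_digraph.digraph_isomorphism_def t d
    by (auto simp: prod_eq_iff split: prod.splits)
  have "inj_on (iso_verts h) (pverts G)"
    using h by (simp add: pre_digraph.digraph_isomorphism_def)
  moreover have "parcs H = (\<lambda>(u, v). (iso_verts h u, iso_verts h v)) ` parcs G"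
    unfolding E using arc by (rule image_cong[OF refl])
  ultimately show ?R using V by blast
next
  assume ?R
  then obtain f where inj: "inj_on f (pverts G)" and V: "pverts H = f ` pverts G"
    and E: "parcs H = (\<lambda>(u, v). (f u, f v)) ` parcs G" by blast
  define h where "h = \<lparr> iso_verts = f, iso_arcs = (\<lambda>(u, v). (f u, f v)),
    iso_head = snd, iso_tail = fst \<rparr>"
  interpret G: pair_wf_digraph G by fact
  have "inj_on (\<lambda>(u, v). (f u, f v)) (parcs G)"
    using inj by (auto simp: inj_on_def dest: G.wellformed')
  then have "pre_digraph.digraph_isomorphism (with_proj G) h"
    using inj G.wf_digraph by (auto simp: pre_digraph.digraph_isomorphism_def h_def)
  moreover have "with_proj H = app_iso h (with_proj G)"
    by (simp add: app_iso_def h_def with_proj_def V E)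
  ultimately show ?L unfolding digraph_iso_def by blast
qed

lemma equiv_graph_iso_rel: "equiv {G. pair_graph G} graph_iso_rel"
proof (rule equivI)
  show "graph_iso_rel \<subseteq> {G. pair_graph G} \<times> {G. pair_graph G}"
    by (auto simp: graph_iso_rel_def)
  show "refl_on {G. pair_graph G} graph_iso_rel"
  proof (rule refl_onI)
    fix G :: "nat pair_pre_digraph"
    assume "G \<in> {G. pair_graph G}"
    then interpret pair_graph G by simp
    have "digraph_iso (with_proj G) (with_proj G)"
      unfolding digraph_iso_with_proj_iff[OF pair_wf_digraph_axioms]
      by (rule exI[of _ id]) auto
    then show "(G, G) \<in> graph_iso_rel" by (simp add: graph_iso_rel_def pair_graph)
  qed
  show "sym graph_iso_rel"
  proof (rule symI)
    fix G H
    assume GH: "(G, H) \<in> graph_iso_rel"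
    then interpret pair_graph G by (simp add: graph_iso_rel_def)
    show "(H, G) \<in> graph_iso_rel"
      using GH by (simp add: graph_iso_rel_def digraph_iso_swap[OF wf_digraph])
  qed
  show "trans graph_iso_rel"
    by (rule transI) (auto simp: graph_iso_rel_def intro: digraph_iso_trans)
qed

end

theory Submission
  imports Defs
begin

text \<open>Let \<open>G\<close> be an NG-graph whose part \<open>A\<close> is a 5-cycle, with parts \<open>B\<close> and \<open>C\<close>. The vertices of
  \<open>C\<close> have degree less than \<open>\<chi>(G) - 1\<close>, so a colouring of \<open>A \<union> B\<close> with \<open>\<chi>(G) - 1\<close> colours would extend
  greedily to \<open>G\<close>; hence \<open>A \<union> B\<close> needs \<open>\<chi>(G)\<close> colours and \<open>\<chi>(G) \<le> |B| + 3\<close>. In the complement \<open>B\<close> and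
  \<open>C\<close> exchange roles, and the sum of the two bounds is \<open>n + 1\<close>, so both are equalities. A missing
  edge inside \<open>B\<close> or between \<open>A\<close> and \<open>B\<close> would save a colour, and dually for an edge inside \<open>C\<close>; the
  degrees then leave no edge between \<open>A\<close> and \<open>C\<close>. Conversely, every 5-cycle that is joined
  completely to a clique \<open>B\<close> and not at all to a stable set \<open>C\<close> arises in this way.

  The unbalanced split graphs have the same description with a single vertex in place of the
  5-cycle. That vertex is not unique, but any two choices are twins. So on both sides an
  isomorphism class is determined by the bipartite graph between \<open>B\<close> and \<open>C\<close> with its sides told apart, and
  contracting the 5-cycle to a vertex removes four vertices.\<close>

section \<open>Degrees and complements\<close>

lemma pair_graph_iff:
  "pair_graph G \<longleftrightarrow> finite (pverts G) \<and> parcs G \<subseteq> pverts G \<times> pverts G \<and>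
     sym (parcs G) \<and> (\<forall>u. (u, u) \<notin> parcs G)" (is "_ \<longleftrightarrow> ?R")
proof
  assume "pair_graph G"
  then interpret pair_graph G .
  show ?R
    using pair_finite_verts wellformed' no_loops' pair_sym_arcs
    by (auto simp: symmetric_def) blast
next
  assume R: ?R
  then have "finite (parcs G)"
    by (meson finite_SigmaI finite_subset)
  with R show "pair_graph G"
    by unfold_locales (auto simp: symmetric_def)
qed

lemma pair_graphD:
  assumes "pair_graph G"
  shows "finite (pverts G)" "(u, v) \<in> parcs G \<Longrightarrow> u \<in> pverts G" "(u, v) \<in> parcs G \<Longrightarrow> v \<in> pverts G"
    "(u, v) \<in> parcs G \<Longrightarrow> (v, u) \<in> parcs G" "(u, u) \<notin> parcs G"
  using assms by (auto simp: pair_graph_iff dest: symD)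

lemma out_degree_eq_card: "out_degree (with_proj G) v = card {w. (v, w) \<in> parcs G}"
proof -
  have "out_arcs (with_proj G) v = Pair v ` {w. (v, w) \<in> parcs G}"
    by (auto simp: out_arcs_def)
  then show ?thesis
    by (simp add: out_degree_def card_image inj_on_def)
qed

lemma pair_graph_complement:
  assumes "pair_graph G"
  shows "pair_graph (graph_complement G)"
  using assms by (auto simp: pair_graph_iff graph_complement_def sym_def)

lemma pverts_complement [simp]: "pverts (graph_complement G) = pverts G"
  by (simp add: graph_complement_def)

lemma complement_iff:
  "(u, v) \<in> parcs (graph_complement G) \<longleftrightarrow>
     u \<in> pverts G \<and> v \<in> pverts G \<and> u \<noteq> v \<and> (u, v) \<notin> parcs G"
  by (simp add: graph_complement_def)

text \<open>Every vertex other than \<open>v\<close> is a neighbour of \<open>v\<close> in exactly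
  one of the two graphs; the summand 1 stands for \<open>v\<close> itself.\<close>

lemma out_degree_complement:
  assumes "pair_graph G" "v \<in> pverts G"
  shows "out_degree (with_proj (graph_complement G)) v + out_degree (with_proj G) v + 1
    = card (pverts G)"
proof -
  let ?N = "{w. (v, w) \<in> parcs G}" and ?M = "{w. (v, w) \<in> parcs (graph_complement G)}"
  have fin: "finite (pverts G)" "?N \<subseteq> pverts G" "?M \<subseteq> pverts G"
    using pair_graphD[OF assms(1)] by (auto simp: complement_iff)
  have "pverts G = insert v (?N \<union> ?M)" "v \<notin> ?N \<union> ?M" "?N \<inter> ?M = {}"
    using pair_graphD[OF assms(1)] assms(2) by (auto simp: complement_iff)
  moreover from this have "finite ?N" "finite ?M"
    using fin by (auto intro: finite_subset)
  ultimately have "card (pverts G) = Suc (card ?N + card ?M)"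
    by (metis card_Un_disjoint card_insert_disjoint finite_UnI)
  then show ?thesis
    by (simp add: out_degree_eq_card)
qed


section \<open>Colourings\<close>

text \<open>Colourings of an induced subgraph are expressed through the edge relation of the whole
  graph and a vertex set \<open>W\<close>, so that pieces can be coloured and reassembled without
  forming subgraphs.\<close>

definition colourable :: "'a rel \<Rightarrow> 'a set \<Rightarrow> nat \<Rightarrow> bool" where
  "colourable E W k \<longleftrightarrow> (\<exists>c. c ` W \<subseteq> {..<k} \<and> (\<forall>u\<in>W. \<forall>v\<in>W. (u, v) \<in> E \<longrightarrow> c u \<noteq> c v))"

lemma colourable_mono: "colourable E W k \<Longrightarrow> W' \<subseteq> W \<Longrightarrow> k \<le> k' \<Longrightarrow> colourable E W' k'"
  unfolding colourable_def by (elim ex_forward) (auto simp: image_subset_iff subset_iff intro: less_le_trans)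

text \<open>The two pieces receive disjoint palettes: the colours of \<open>W'\<close> are shifted
  by \<open>k\<close>. On an overlap the colour from \<open>W\<close> wins.\<close>

lemma colourable_Un:
  assumes "colourable E W k" "colourable E W' l"
  shows "colourable E (W \<union> W') (k + l)"
proof -
  obtain c where c: "\<And>v. v \<in> W \<Longrightarrow> c v < k"
      "\<And>u v. u \<in> W \<Longrightarrow> v \<in> W \<Longrightarrow> (u, v) \<in> E \<Longrightarrow> c u \<noteq> c v"
    using assms(1) unfolding colourable_def by (auto simp: image_subset_iff)
  obtain c' where c': "\<And>v. v \<in> W' \<Longrightarrow> c' v < l"
      "\<And>u v. u \<in> W' \<Longrightarrow> v \<in> W' \<Longrightarrow> (u, v) \<in> E \<Longrightarrow> c' u \<noteq> c' v"
    using assms(2) unfolding colourable_def by (auto simp: image_subset_iff)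
  let ?d = "\<lambda>v. if v \<in> W then c v else k + c' v"
  have "?d ` (W \<union> W') \<subseteq> {..<k + l}"
    using c(1) c'(1) by (auto intro: trans_less_add1)
  moreover have "?d u \<noteq> ?d v" if "u \<in> W \<union> W'" "v \<in> W \<union> W'" "(u, v) \<in> E" for u v
    using that c(2) c'(2) c(1)[of u] c(1)[of v] by auto
  ultimately show ?thesis
    unfolding colourable_def by (intro exI[of _ ?d]) blast
qed

lemma colourable_card:
  assumes "finite W" "\<forall>u. (u, u) \<notin> E"
  shows "colourable E W (card W)"
proof -
  obtain c where "bij_betw c W {..<card W}"
    using ex_bij_betw_finite_nat[OF assms(1)] by (auto simp: atLeast0LessThan)
  then show ?thesis
    using assms(2) unfolding colourable_def bij_betw_def inj_on_def
    by (intro exI[of _ c]) (metis order_refl)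
qed

lemma colourable_nonadjacent:
  assumes "\<forall>u. (u, u) \<notin> E" "(a, b) \<notin> E" "(b, a) \<notin> E"
  shows "colourable E {a, b} 1"
  using assms unfolding colourable_def by (intro exI[of _ "\<lambda>_. 0"]) auto

text \<open>The non-adjacent pair \<open>a\<close>, \<open>b\<close> shares one colour and every
  other vertex has its own. This is how a missing edge saves a colour.\<close>

lemma colourable_non_clique:
  assumes "finite W" "\<forall>u. (u, u) \<notin> E" "a \<in> W" "b \<in> W" "a \<noteq> b" "(a, b) \<notin> E" "(b, a) \<notin> E"
  shows "colourable E W (card W - 1)"
proof -
  have "card {a, b} \<le> card W"
    using assms by (intro card_mono) auto
  then have "1 + card (W - {a, b}) = card W - 1"
    using assms by (simp add: card_Diff_subset)
  moreover have "{a, b} \<union> (W - {a, b}) = W"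
    using assms by auto
  ultimately show ?thesis
    using colourable_Un[OF colourable_nonadjacent[OF assms(2,6,7)]
        colourable_card[of "W - {a, b}" E]] assms(1,2)
    by simp
qed

text \<open>Vertices of \<open>D\<close> are added one at a time. Since the degree bound counts all
  neighbours, the order does not matter and some colour is always free.\<close>

lemma colourable_greedy:
  assumes "finite D" "sym E" "\<forall>u. (u, u) \<notin> E" "colourable E W k"
    and "\<And>v. v \<in> D \<Longrightarrow> finite {w. (v, w) \<in> E} \<and> card {w. (v, w) \<in> E} < k"
  shows "colourable E (W \<union> D) k"
  using assms(1,5)
proof (induction D)
  case empty
  then show ?case using assms(4) by simp
next
  case (insert x D)
  then obtain c where c: "c ` (W \<union> D) \<subseteq> {..<k}"
      "\<And>u v. u \<in> W \<union> D \<Longrightarrow> v \<in> W \<union> D \<Longrightarrow> (u, v) \<in> E \<Longrightarrow> c u \<noteq> c v"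
    unfolding colourable_def by (metis insertCI)
  \<comment> \<open>Neighbours that are not yet coloured contribute arbitrary values of
    \<open>c\<close>, which is harmless because only the size of the image is bounded.\<close>
  have "card (c ` {w. (x, w) \<in> E}) < card {..<k}"
    using insert.prems[of x] card_image_le[of "{w. (x, w) \<in> E}" c] by simp
  then have "\<not> {..<k} \<subseteq> c ` {w. (x, w) \<in> E}"
    using insert.prems[of x] card_mono[of "c ` {w. (x, w) \<in> E}" "{..<k}"] by auto
  then obtain m where m: "m < k" "m \<notin> c ` {w. (x, w) \<in> E}"
    by auto
  show ?case
  proof (cases "x \<in> W")
    case True
    then show ?thesis using insert by (auto simp: insert_absorb)
  next
    case False
    have "(c(x := m)) ` (W \<union> insert x D) \<subseteq> {..<k}"
      using c(1) m(1) by auto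
    moreover have "(c(x := m)) u \<noteq> (c(x := m)) v"
      if "u \<in> W \<union> insert x D" "v \<in> W \<union> insert x D" "(u, v) \<in> E" for u v
      using that c(2) m(2) assms(3) symD[OF assms(2) that(3)] by (auto simp: image_iff)
    ultimately show ?thesis
      unfolding colourable_def by (intro exI[of _ "c(x := m)"]) blast
  qed
qed

text \<open>Giving all vertices different colours shows that the least number exists; monotonicity
  in the number of colours then yields the equivalence.\<close>

lemma colourable_iff_chromatic_number:
  assumes "pair_graph G"
  shows "colourable (parcs G) (pverts G) k \<longleftrightarrow> chromatic_number G \<le> k"
proof -
  have eq: "colourable (parcs G) (pverts G) k \<longleftrightarrow> (\<exists>c. proper_colouring G k c)" for k
    using pair_graphD[OF assms] unfolding colourable_def proper_colouring_def
    by (intro ex_cong1) fast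
  have "colourable (parcs G) (pverts G) (card (pverts G))"
    using pair_graphD[OF assms] by (intro colourable_card) auto
  then have "colourable (parcs G) (pverts G) (chromatic_number G)"
    unfolding eq chromatic_number_def by (rule LeastI)
  then show ?thesis
    using colourable_mono by (metis Least_le chromatic_number_def eq subset_refl)
qed

text \<open>Otherwise the greedy extension to \<open>D\<close> would colour all of \<open>G\<close>
  with \<chi>(G) - 1 colours. Positivity makes the truncated difference genuinely smaller than
  \<chi>(G).\<close>

lemma colourable_low_degree:
  assumes "pair_graph G" "D \<subseteq> pverts G" "W \<union> D = pverts G" "chromatic_number G > 0"
    and "\<And>v. v \<in> D \<Longrightarrow> int (out_degree (with_proj G) v) < int (chromatic_number G) - 1"
  shows "\<not> colourable (parcs G) W (chromatic_number G - 1)"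
proof
  assume W: "colourable (parcs G) W (chromatic_number G - 1)"
  note G = pair_graphD[OF assms(1)]
  have fin: "finite {w. (v, w) \<in> parcs G}" for v
    by (rule finite_subset[OF _ G(1)]) (auto dest: G(3))
  have "colourable (parcs G) (W \<union> D) (chromatic_number G - 1)"
  proof (rule colourable_greedy[OF _ _ _ W])
    show "finite D" using assms(2) G(1) by (rule finite_subset)
    show "finite {w. (v, w) \<in> parcs G} \<and> card {w. (v, w) \<in> parcs G} < chromatic_number G - 1"
      if "v \<in> D" for v
      using assms(5)[OF that] fin by (simp add: out_degree_eq_card)
  qed (use G in \<open>auto simp: sym_def\<close>)
  then show False
    using assms(3,4) colourable_iff_chromatic_number[OF assms(1)] by simp
qed


section \<open>Substituting a graph between a clique and a stable set\<close>

text \<open>The set \<open>A\<close> spans a copy of \<open>P\<close> in \<open>G\<close>. The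
  vertex types may differ, and for \<open>A = pverts G\<close> this is isomorphism of
  \<open>P\<close> and \<open>G\<close> when both are well-formed.\<close>

definition induces :: "'b pair_pre_digraph \<Rightarrow> 'a pair_pre_digraph \<Rightarrow> 'a set \<Rightarrow> bool" where
  "induces P G A \<longleftrightarrow> (\<exists>g. bij_betw g (pverts P) A \<and>
     (\<forall>i\<in>pverts P. \<forall>j\<in>pverts P. (g i, g j) \<in> parcs G \<longleftrightarrow> (i, j) \<in> parcs P))"

text \<open>The common shape of both classes: \<open>P\<close> is the 5-cycle for
  \<open>NG_3\<close> and a single vertex for unbalanced split graphs. Only the edges between
  \<open>B\<close> and \<open>C\<close> are left free.\<close>

definition split_extension ::
    "'b pair_pre_digraph \<Rightarrow> 'a pair_pre_digraph \<Rightarrow> 'a set \<Rightarrow> 'a set \<Rightarrow> 'a set \<Rightarrow> bool" where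
  "split_extension P G A B C \<longleftrightarrow> pair_graph G \<and> pverts G = A \<union> B \<union> C \<and>
     A \<inter> B = {} \<and> A \<inter> C = {} \<and> B \<inter> C = {} \<and> induces P G A \<and> is_clique G B \<and> is_stable G C \<and>
     (\<forall>a\<in>A. \<forall>b\<in>B. (a, b) \<in> parcs G) \<and> (\<forall>a\<in>A. \<forall>c\<in>C. (a, c) \<notin> parcs G)"

lemma split_extension_finite:
  assumes "split_extension P G A B C"
  shows "finite A" "finite B" "finite C"
  using assms by (auto simp: split_extension_def pair_graph_iff)

lemma induces_card: "induces P G A \<Longrightarrow> card A = card (pverts P)"
  by (auto simp: induces_def dest: bij_betw_same_card)

lemma split_extension_card:
  assumes "split_extension P G A B C"
  shows "card (pverts G) = card (pverts P) + card B + card C"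
  using assms split_extension_finite[OF assms] induces_card[of P G A]
  by (auto simp: split_extension_def card_Un_disjoint Int_Un_distrib2)

section \<open>Isomorphism expressed as an induced copy\<close>

lemma pair_wf_cycle_graph: "pair_wf_digraph (cycle_graph m)"
  by unfold_locales (auto simp: cycle_graph_def)

lemma digraph_iso_iff_induces:
  assumes P: "pair_wf_digraph P" and H: "pair_wf_digraph H"
  shows "digraph_iso (with_proj P) (with_proj H) \<longleftrightarrow> induces P H (pverts H)"
proof -
  have "parcs H = (\<lambda>(u, v). (f u, f v)) ` parcs P \<longleftrightarrow>
    (\<forall>i\<in>pverts P. \<forall>j\<in>pverts P. (f i, f j) \<in> parcs H \<longleftrightarrow> (i, j) \<in> parcs P)" (is "_ = ?R \<longleftrightarrow> ?S")
    if f: "inj_on f (pverts P)" "pverts H = f ` pverts P" for f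
  proof -
    have R: "(f i, f j) \<in> ?R \<longleftrightarrow> (i, j) \<in> parcs P" if ij: "i \<in> pverts P" "j \<in> pverts P" for i j
    proof
      assume "(f i, f j) \<in> ?R"
      then obtain i' j' where e: "(i', j') \<in> parcs P" "f i = f i'" "f j = f j'"
        by auto
      then have "i = i'" "j = j'"
        using f(1) pair_wf_digraph.wellformed'[OF P e(1)] ij by (auto dest: inj_onD)
      with e show "(i, j) \<in> parcs P" by simp
    next
      assume "(i, j) \<in> parcs P"
      then show "(f i, f j) \<in> ?R"
        by (rule rev_image_eqI) simp
    qed
    \<comment> \<open>Both arc sets lie in the square of \<open>pverts H\<close>, so their equality
      can be tested on pairs of vertices, and every such vertex has the form
      \<open>f i\<close>.\<close>
    have "parcs H \<subseteq> pverts H \<times> pverts H" "?R \<subseteq> pverts H \<times> pverts H"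
      using f(2) pair_wf_digraph.wellformed'[OF P] pair_wf_digraph.wellformed'[OF H] by auto
    moreover have "X = Y \<longleftrightarrow> (\<forall>u\<in>V. \<forall>v\<in>V. (u, v) \<in> X \<longleftrightarrow> (u, v) \<in> Y)"
      if "X \<subseteq> V \<times> V" "Y \<subseteq> V \<times> V" for X Y V
      using that by blast
    ultimately have "parcs H = ?R \<longleftrightarrow>
        (\<forall>u\<in>pverts H. \<forall>v\<in>pverts H. (u, v) \<in> parcs H \<longleftrightarrow> (u, v) \<in> ?R)"
      by metis
    also have "\<dots> \<longleftrightarrow> (\<forall>i\<in>pverts P. \<forall>j\<in>pverts P. (f i, f j) \<in> parcs H \<longleftrightarrow> (f i, f j) \<in> ?R)"
      unfolding f(2) ball_simps ..
    also have "\<dots> \<longleftrightarrow> ?S"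
      using R by (intro ball_cong refl) simp
    finally show ?thesis .
  qed
  then have "inj_on f (pverts P) \<and> pverts H = f ` pverts P \<and>
      parcs H = (\<lambda>(u, v). (f u, f v)) ` parcs P \<longleftrightarrow> bij_betw f (pverts P) (pverts H) \<and>
      (\<forall>i\<in>pverts P. \<forall>j\<in>pverts P. (f i, f j) \<in> parcs H \<longleftrightarrow> (i, j) \<in> parcs P)" for f
    unfolding bij_betw_def conj_assoc eq_commute[of "f ` pverts P" "pverts H"]
    by (intro conj_cong refl)
  then show ?thesis
    unfolding digraph_iso_with_proj_iff[OF P] induces_def by (rule ex_cong1)
qed

text \<open>The induced subgraph is itself the digraph of a pair graph. The direction of the
  isomorphism is reversed, since \<open>induces\<close> maps from the pattern \<open>P\<close> into
  \<open>G\<close>.\<close>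

lemma digraph_iso_induce_iff:
  assumes "pair_wf_digraph P"
  shows "digraph_iso (with_proj G \<restriction> A) (with_proj P) \<longleftrightarrow> induces P G A"
proof -
  let ?H = "\<lparr>pverts = A, parcs = {(u, v) \<in> parcs G. u \<in> A \<and> v \<in> A}\<rparr>"
  have H: "with_proj G \<restriction> A = with_proj ?H"
    by (auto simp: induce_subgraph_def with_proj_def)
  have wf: "pair_wf_digraph ?H"
    by (rule pair_wf_digraph.intro) auto
  have "digraph_iso (with_proj ?H) (with_proj P) \<longleftrightarrow> digraph_iso (with_proj P) (with_proj ?H)"
    using digraph_iso_swap[of "with_proj ?H" "with_proj P"] wf assms
      digraph_iso_swap[of "with_proj P" "with_proj ?H"] unfolding wf_digraph_wp_iff by blast
  also have "\<dots> \<longleftrightarrow> induces P ?H A"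
    using digraph_iso_iff_induces[OF assms wf] by simp
  also have "\<dots> \<longleftrightarrow> induces P G A"
    unfolding induces_def bij_betw_def by (intro ex_cong1) auto
  finally show ?thesis
    unfolding H .
qed

section \<open>The 5-cycle: rotations, complement and colourings\<close>

lemma pverts_C5 [simp]: "pverts (cycle_graph 5) = {0, 1, 2, 3, 4}"
  by (auto simp: cycle_graph_def)

lemma parcs_C5: "(i, j) \<in> parcs (cycle_graph 5) \<longleftrightarrow>
    (i, j) \<in> {(0, 1), (1, 2), (2, 3), (3, 4), (4, 0), (1, 0), (2, 1), (3, 2), (4, 3), (0, 4)}"
proof -
  have lt: "i < 5 \<longleftrightarrow> i \<in> {0, 1, 2, 3, 4}" for i :: nat
    by auto
  show ?thesis
  proof (cases "i < 5 \<and> j < 5")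
    case True
    then have "i \<in> {0, 1, 2, 3, 4}" "j \<in> {0, 1, 2, 3, 4}"
      by (simp_all only: lt)
    then show ?thesis
      unfolding cycle_graph_def by (elim insertE emptyE) simp_all
  next
    case False
    then show ?thesis
      by (auto simp: cycle_graph_def)
  qed
qed

text \<open>By rotation any vertex \<open>a\<close> of the cycle may come first. The ten listed
  pairs, five sides and five diagonals, are all the pairs of vertices.\<close>

lemma induces_C5E:
  assumes "induces (cycle_graph 5) G A" "a \<in> A" "pair_graph G"
  obtains p q r s where "A = {a, p, q, r, s}" "distinct [a, p, q, r, s]"
    "(a, p) \<in> parcs G" "(p, q) \<in> parcs G" "(q, r) \<in> parcs G" "(r, s) \<in> parcs G" "(s, a) \<in> parcs G"
    "(a, q) \<notin> parcs G" "(p, r) \<notin> parcs G" "(q, s) \<notin> parcs G" "(r, a) \<notin> parcs G" "(s, p) \<notin> parcs G"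
proof -
  obtain g where g: "bij_betw g {0, 1, 2, 3, 4} A" and
    E: "\<And>i j. i \<in> {0, 1, 2, 3, 4} \<Longrightarrow> j \<in> {0, 1, 2, 3, 4} \<Longrightarrow>
      (g i, g j) \<in> parcs G \<longleftrightarrow> (i, j) \<in> parcs (cycle_graph 5)"
    using assms(1) unfolding induces_def pverts_C5 by blast
  have A: "A = {g 0, g 1, g 2, g 3, g 4}"
    using bij_betw_imp_surj_on[OF g] by auto
  have d: "distinct [g 0, g 1, g 2, g 3, g 4]"
    using bij_betw_imp_inj_on[OF g] by (auto simp: inj_on_def)
  have e: "(g 0, g 1) \<in> parcs G" "(g 1, g 2) \<in> parcs G" "(g 2, g 3) \<in> parcs G"
    "(g 3, g 4) \<in> parcs G" "(g 4, g 0) \<in> parcs G"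
    "(g 0, g 2) \<notin> parcs G" "(g 1, g 3) \<notin> parcs G" "(g 2, g 4) \<notin> parcs G"
    "(g 3, g 0) \<notin> parcs G" "(g 4, g 1) \<notin> parcs G"
    by (simp_all add: E parcs_C5)
  consider "a = g 0" | "a = g 1" | "a = g 2" | "a = g 3" | "a = g 4"
    using assms(2) A by blast
  then show thesis
  proof cases
    case 1
    moreover have "A = {g 0, g 1, g 2, g 3, g 4}" unfolding A by blast
    ultimately show ?thesis by (intro that[of "g 1" "g 2" "g 3" "g 4"]) (use d e in \<open>auto simp del: One_nat_def\<close>)
  next
    case 2
    moreover have "A = {g 1, g 2, g 3, g 4, g 0}" unfolding A by blast
    ultimately show ?thesis by (intro that[of "g 2" "g 3" "g 4" "g 0"]) (use d e in \<open>auto simp del: One_nat_def\<close>)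
  next
    case 3
    moreover have "A = {g 2, g 3, g 4, g 0, g 1}" unfolding A by blast
    ultimately show ?thesis by (intro that[of "g 3" "g 4" "g 0" "g 1"]) (use d e in \<open>auto simp del: One_nat_def\<close>)
  next
    case 4
    moreover have "A = {g 3, g 4, g 0, g 1, g 2}" unfolding A by blast
    ultimately show ?thesis by (intro that[of "g 4" "g 0" "g 1" "g 2"]) (use d e in \<open>auto simp del: One_nat_def\<close>)
  next
    case 5
    moreover have "A = {g 4, g 0, g 1, g 2, g 3}" unfolding A by blast
    ultimately show ?thesis by (intro that[of "g 0" "g 1" "g 2" "g 3"]) (use d e in \<open>auto simp del: One_nat_def\<close>)
  qed
qed

text \<open>Position in the list is the isomorphism; the remaining orientations and the loops are
  settled by symmetry and irreflexivity.\<close>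

lemma induces_C5I:
  assumes "distinct [a, p, q, r, s]" "pair_graph G"
    "(a, p) \<in> parcs G" "(p, q) \<in> parcs G" "(q, r) \<in> parcs G" "(r, s) \<in> parcs G" "(s, a) \<in> parcs G"
    "(a, q) \<notin> parcs G" "(p, r) \<notin> parcs G" "(q, s) \<notin> parcs G" "(r, a) \<notin> parcs G" "(s, p) \<notin> parcs G"
  shows "induces (cycle_graph 5) G {a, p, q, r, s}"
proof -
  let ?g = "\<lambda>i. [a, p, q, r, s] ! i"
  have "bij_betw ?g {0, 1, 2, 3, 4} {a, p, q, r, s}"
    using assms(1) unfolding bij_betw_def inj_on_def by auto
  moreover have "(?g i, ?g j) \<in> parcs G \<longleftrightarrow> (i, j) \<in> parcs (cycle_graph 5)"
    if "i \<in> {0, 1, 2, 3, 4}" "j \<in> {0, 1, 2, 3, 4}" for i j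
  proof -
    have "(x, y) \<in> parcs G \<longleftrightarrow> (y, x) \<in> parcs G" "(x, x) \<notin> parcs G" for x y
      using pair_graphD(4,5)[OF assms(2)] by auto
    with assms(3-) have "(p, a) \<in> parcs G" "(q, p) \<in> parcs G" "(r, q) \<in> parcs G"
      "(s, r) \<in> parcs G" "(a, s) \<in> parcs G" "(q, a) \<notin> parcs G" "(r, p) \<notin> parcs G"
      "(s, q) \<notin> parcs G" "(a, r) \<notin> parcs G" "(p, s) \<notin> parcs G" "\<And>x. (x, x) \<notin> parcs G"
      by blast+
    with assms(3-) that show ?thesis
      unfolding parcs_C5 by (elim insertE emptyE) simp_all
  qed
  ultimately show ?thesis
    unfolding induces_def pverts_C5 by blast
qed

text \<open>The 5-cycle is self-complementary. Hence every argument about \<open>B\<close> in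
  \<open>G\<close> can be repeated for \<open>C\<close> in the complement.\<close>

lemma induces_C5_complement:
  assumes "induces (cycle_graph 5) G A" "A \<subseteq> pverts G" "pair_graph G"
  shows "induces (cycle_graph 5) (graph_complement G) A"
proof -
  have "A \<noteq> {}"
    using induces_card[OF assms(1)] by auto
  then obtain a where "a \<in> A" by blast
  from assms(1) this assms(3) show ?thesis
  proof (rule induces_C5E)
    fix p q r s
    assume A: "A = {a, p, q, r, s}" and *: "distinct [a, p, q, r, s]"
      "(a, p) \<in> parcs G" "(p, q) \<in> parcs G" "(q, r) \<in> parcs G" "(r, s) \<in> parcs G" "(s, a) \<in> parcs G"
      "(a, q) \<notin> parcs G" "(p, r) \<notin> parcs G" "(q, s) \<notin> parcs G" "(r, a) \<notin> parcs G" "(s, p) \<notin> parcs G"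
    \<comment> \<open>Steps of two around the cycle run through its diagonals, which are the edges
      of the complement.\<close>
    have "induces (cycle_graph 5) (graph_complement G) {a, q, s, p, r}"
      using * assms(2) pair_graphD(4)[OF assms(3)]
      by (intro induces_C5I pair_graph_complement assms(3)) (auto simp: A complement_iff)
    moreover have "{a, q, s, p, r} = A"
      unfolding A by auto
    ultimately show ?thesis by simp
  qed
qed

text \<open>Without \<open>a\<close> a path on four vertices remains, and its alternate vertices
  form two stable pairs.\<close>

lemma C5_colourable_minus:
  assumes "induces (cycle_graph 5) G A" "a \<in> A" "pair_graph G"
  shows "colourable (parcs G) (A - {a}) 2"
  using assms
proof (rule induces_C5E)
  fix p q r s
  assume A: "A = {a, p, q, r, s}" and *: "distinct [a, p, q, r, s]"
    "(p, r) \<notin> parcs G" "(q, s) \<notin> parcs G"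
  note G = pair_graphD(4,5)[OF assms(3)]
  have "A - {a} = {p, r} \<union> {q, s}"
    using A *(1) by auto
  then show ?thesis
    using colourable_Un[OF colourable_nonadjacent[of "parcs G" p r]
        colourable_nonadjacent[of "parcs G" q s]] * G by (auto simp: numeral_2_eq_2)
qed

lemma C5_colourable:
  assumes "induces (cycle_graph 5) G A" "pair_graph G"
  shows "colourable (parcs G) A 3"
proof -
  have "A \<noteq> {}"
    using induces_card[OF assms(1)] by auto
  then obtain a where a: "a \<in> A" by blast
  have "colourable (parcs G) {a} 1"
    using colourable_nonadjacent[of "parcs G" a a] pair_graphD(5)[OF assms(2)] by auto
  from colourable_Un[OF this C5_colourable_minus[OF assms(1) a assms(2)]] a show ?thesis
    by (simp add: insert_absorb numeral_3_eq_3 numeral_2_eq_2)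
qed

text \<open>An odd cycle needs three colours. The bound is on the image of \<open>A\<close>, because
  the colours of \<open>B\<close> will be counted separately.\<close>

lemma C5_card_colours:
  assumes "induces (cycle_graph 5) G A" "pair_graph G"
    and c: "\<And>u v. u \<in> A \<Longrightarrow> v \<in> A \<Longrightarrow> (u, v) \<in> parcs G \<Longrightarrow> c u \<noteq> c v"
  shows "3 \<le> card (c ` A)"
proof -
  have "A \<noteq> {}"
    using induces_card[OF assms(1)] by auto
  then obtain a where "a \<in> A" by blast
  from assms(1) this assms(2) show ?thesis
  proof (rule induces_C5E)
    fix p q r s
    assume A: "A = {a, p, q, r, s}" and *:
      "(a, p) \<in> parcs G" "(p, q) \<in> parcs G" "(q, r) \<in> parcs G" "(r, s) \<in> parcs G" "(s, a) \<in> parcs G"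
    have "c a \<noteq> c p" "c p \<noteq> c q" "c q \<noteq> c r" "c r \<noteq> c s" "c s \<noteq> c a"
      using c[OF _ _ *(1)] c[OF _ _ *(2)] c[OF _ _ *(3)] c[OF _ _ *(4)] c[OF _ _ *(5)]
      by (simp_all add: A)
    \<comment> \<open>If \<open>c q\<close> differs from \<open>c a\<close>, the vertices
      \<open>a\<close>, \<open>p\<close>, \<open>q\<close> serve; otherwise \<open>p\<close>,
      \<open>q\<close>, \<open>r\<close> do, unless \<open>c r = c p\<close>, and then
      \<open>a\<close>, \<open>p\<close>, \<open>s\<close> do.\<close>
    then have "\<exists>x\<in>c ` A. \<exists>y\<in>c ` A. \<exists>z\<in>c ` A. x \<noteq> y \<and> y \<noteq> z \<and> x \<noteq> z"
      unfolding A by (cases "c q = c a"; cases "c r = c p") auto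
    then obtain x y z where "{x, y, z} \<subseteq> c ` A" "x \<noteq> y" "y \<noteq> z" "x \<noteq> z"
      by blast
    moreover have "finite (c ` A)"
      unfolding A by simp
    ultimately show ?thesis
      using card_mono[of "c ` A" "{x, y, z}"] by simp
  qed
qed

lemma C5_card_neighbours:
  assumes "induces (cycle_graph 5) G A" "a \<in> A" "pair_graph G"
  shows "card {w \<in> A. (a, w) \<in> parcs G} = 2"
  using assms
proof (rule induces_C5E)
  fix p q r s
  assume A: "A = {a, p, q, r, s}" and *: "distinct [a, p, q, r, s]"
    "(a, p) \<in> parcs G" "(s, a) \<in> parcs G" "(a, q) \<notin> parcs G" "(r, a) \<notin> parcs G"
  have "{w \<in> A. (a, w) \<in> parcs G} = {p, s}"
    using * pair_graphD(4,5)[OF assms(3)] unfolding A by auto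
  then show ?thesis
    using *(1) by simp
qed

section \<open>Extensions of the 5-cycle are exactly the graphs in \<open>NG_3\<close>\<close>

lemma split_extension_C5_complement:
  assumes "split_extension (cycle_graph 5) G A B C"
  shows "split_extension (cycle_graph 5) (graph_complement G) A C B"
proof -
  have G: "pair_graph G" and "induces (cycle_graph 5) G A" "A \<subseteq> pverts G"
    using assms by (auto simp: split_extension_def)
  with assms pair_graph_complement[OF G] induces_C5_complement[of G A] show ?thesis
    by (auto simp: split_extension_def is_clique_def is_stable_def complement_iff)
qed

text \<open>Three colours for the cycle and one for each vertex of \<open>B\<close> suffice, as
  vertices of \<open>C\<close> have neighbours only in \<open>B\<close>. They are necessary because
  \<open>B\<close> is a clique joined to the whole cycle.\<close>

lemma split_extension_C5_chromatic_number:
  assumes ext: "split_extension (cycle_graph 5) G A B C"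
  shows "chromatic_number G = card B + 3"
proof -
  note fin = split_extension_finite[OF ext]
  have pg: "pair_graph G" and V: "pverts G = A \<union> B \<union> C" and ind: "induces (cycle_graph 5) G A"
    using ext by (auto simp: split_extension_def)
  note G = pair_graphD[OF pg]
  have "colourable (parcs G) ((A \<union> B) \<union> C) (3 + card B)"
  proof (rule colourable_greedy)
    show "colourable (parcs G) (A \<union> B) (3 + card B)"
      using G fin by (intro colourable_Un C5_colourable colourable_card ind pg) auto
    show "finite {w. (v, w) \<in> parcs G} \<and> card {w. (v, w) \<in> parcs G} < 3 + card B"
      if "v \<in> C" for v
    proof -
      have N: "{w. (v, w) \<in> parcs G} \<subseteq> B"
      proof
        fix w assume w: "w \<in> {w. (v, w) \<in> parcs G}"
        then have "w \<in> A \<union> B \<union> C" "(w, v) \<in> parcs G"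
          using G(3,4) V by auto
        then show "w \<in> B"
          using ext that w by (auto simp: split_extension_def is_stable_def)
      qed
      show ?thesis
        using card_mono[OF fin(2) N] finite_subset[OF N fin(2)] by simp
    qed
  qed (use G fin in \<open>auto simp: sym_def\<close>)
  then have "chromatic_number G \<le> 3 + card B"
    using colourable_iff_chromatic_number[OF pg] V by simp
  moreover have "card B + 3 \<le> k" if "colourable (parcs G) (pverts G) k" for k
  proof -
    obtain c where c: "\<And>v. v \<in> pverts G \<Longrightarrow> c v < k"
      "\<And>u v. u \<in> pverts G \<Longrightarrow> v \<in> pverts G \<Longrightarrow> (u, v) \<in> parcs G \<Longrightarrow> c u \<noteq> c v"
      using \<open>colourable (parcs G) (pverts G) k\<close> unfolding colourable_def
      by (auto simp: image_subset_iff)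
    have "inj_on c B"
      using c(2) ext unfolding inj_on_def split_extension_def is_clique_def by (metis subsetD)
    moreover have "c ` A \<inter> c ` B = {}"
      using c(2) ext V by (auto simp: split_extension_def)
    moreover have "3 \<le> card (c ` A)"
      using c(2) V by (intro C5_card_colours[OF ind pg]) auto
    moreover have "card (c ` A \<union> c ` B) \<le> card {..<k}"
      using c(1) V by (intro card_mono) auto
    ultimately show ?thesis
      using fin by (simp add: card_Un_disjoint card_image)
  qed
  ultimately show ?thesis
    using colourable_iff_chromatic_number[OF pg, of "chromatic_number G"] by (simp add: le_antisym)
qed

lemma ABC_partition: "pverts G = A_part G \<union> B_part G \<union> C_part G"
    "A_part G \<inter> B_part G = {}" "A_part G \<inter> C_part G = {}" "B_part G \<inter> C_part G = {}"
  by (auto simp: A_part_def B_part_def C_part_def)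

text \<open>With \<chi>(G) - 1 = |B| + 2, a vertex of \<open>A\<close> has degree |B| + 2, one of
  \<open>B\<close> at least |B| + 4 and one of \<open>C\<close> at most |B|. So the decomposition is
  unique.\<close>

lemma split_extension_C5_ABC:
  assumes ext: "split_extension (cycle_graph 5) G A B C"
  shows "A = A_part G" "B = B_part G" "C = C_part G"
proof -
  note fin = split_extension_finite[OF ext]
  have pg: "pair_graph G" and V: "pverts G = A \<union> B \<union> C" and ind: "induces (cycle_graph 5) G A"
    and disj: "A \<inter> B = {}" "A \<inter> C = {}" "B \<inter> C = {}"
    using ext by (auto simp: split_extension_def)
  note G = pair_graphD[OF pg]
  note chi = split_extension_C5_chromatic_number[OF ext]
  have "A \<subseteq> A_part G"
  proof
    fix a assume a: "a \<in> A"
    have "{w. (a, w) \<in> parcs G} = {w \<in> A. (a, w) \<in> parcs G} \<union> B"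
      using ext a G(3)[of a] V unfolding split_extension_def by blast
    moreover have "card ({w \<in> A. (a, w) \<in> parcs G} \<union> B) = 2 + card B"
      using C5_card_neighbours[OF ind a pg] disj(1) fin by (subst card_Un_disjoint) auto
    ultimately show "a \<in> A_part G"
      using a V chi by (simp add: A_part_def out_degree_eq_card)
  qed
  moreover have "B \<subseteq> B_part G"
  proof
    fix b assume b: "b \<in> B"
    have "A \<union> (B - {b}) \<subseteq> {w. (b, w) \<in> parcs G}"
      using ext b G(4) by (auto simp: split_extension_def is_clique_def)
    moreover have "finite {w. (b, w) \<in> parcs G}"
      by (rule finite_subset[OF _ G(1)]) (auto dest: G(3))
    ultimately have "card (A \<union> (B - {b})) \<le> card {w. (b, w) \<in> parcs G}"
      by (rule card_mono[rotated])
    moreover have "card (A \<union> (B - {b})) = 5 + (card B - 1)"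
      using disj(1) fin b induces_card[OF ind] by (subst card_Un_disjoint) auto
    ultimately show "b \<in> B_part G"
      using b V chi by (simp add: B_part_def out_degree_eq_card)
  qed
  moreover have "C \<subseteq> C_part G"
  proof
    fix c assume c: "c \<in> C"
    have "{w. (c, w) \<in> parcs G} \<subseteq> B"
    proof
      fix w assume w: "w \<in> {w. (c, w) \<in> parcs G}"
      then have "w \<in> A \<union> B \<union> C" "(w, c) \<in> parcs G"
        using G(3,4) V by auto
      then show "w \<in> B"
        using ext c w by (auto simp: split_extension_def is_stable_def)
    qed
    then have "card {w. (c, w) \<in> parcs G} \<le> card B"
      using fin by (intro card_mono)
    then show "c \<in> C_part G"
      using c V chi by (simp add: C_part_def out_degree_eq_card)
  qed
  \<comment> \<open>Both triples partition the vertex set, so the three inclusions are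
    equalities.\<close>
  ultimately show "A = A_part G" "B = B_part G" "C = C_part G"
    using ABC_partition[of G] V disj by blast+
qed

text \<open>The complement is again an extension of the 5-cycle, so the chromatic numbers add up to
  (|B| + 3) + (|C| + 3), one more than the 5 + |B| + |C| vertices.\<close>

lemma split_extension_C5_NG_3:
  assumes ext: "split_extension (cycle_graph 5) G A B C"
  shows "G \<in> NG_3"
proof -
  have pg: "pair_graph G" and ind: "induces (cycle_graph 5) G A"
    using ext by (auto simp: split_extension_def)
  have "NG_graph G"
    using split_extension_C5_chromatic_number[OF ext] split_extension_card[OF ext]
      split_extension_C5_chromatic_number[OF split_extension_C5_complement[OF ext]] pg
    by (simp add: NG_graph_def)
  then show ?thesis
    using ind by (simp add: NG_3_def split_extension_C5_ABC(1)[OF ext, symmetric]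
        digraph_iso_induce_iff[OF pair_wf_cycle_graph])
qed

lemma NG_3_split_extension:
  assumes "G \<in> NG_3"
  shows "split_extension (cycle_graph 5) G (A_part G) (B_part G) (C_part G)"
proof -
  define A B C where ABC: "A = A_part G" "B = B_part G" "C = C_part G"
  define H where "H = graph_complement G"
  define k l where "k = chromatic_number G" and "l = chromatic_number H"
  have pg: "pair_graph G" and kl: "k + l = card (pverts G) + 1"
    using assms by (auto simp: NG_3_def NG_graph_def k_def l_def H_def)
  note G = pair_graphD[OF pg]
  have ph: "pair_graph H"
    using pair_graph_complement[OF pg] by (simp add: H_def)
  note H = pair_graphD[OF ph]
  have V: "pverts G = A \<union> B \<union> C" and disj: "A \<inter> B = {}" "A \<inter> C = {}" "B \<inter> C = {}"
    using ABC_partition[of G] by (auto simp: ABC)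
  have VH: "pverts H = A \<union> B \<union> C"
    using V by (simp add: H_def)
  have fin: "finite A" "finite B" "finite C"
    using G(1) V by auto
  have ind: "induces (cycle_graph 5) G A"
    using assms by (simp add: NG_3_def ABC digraph_iso_induce_iff[OF pair_wf_cycle_graph])
  then have indH: "induces (cycle_graph 5) H A"
    using induces_C5_complement[of G A] pg V by (auto simp: H_def)
  have cardA: "card A = 5"
    using induces_card[OF ind] by simp
  have card: "card (pverts G) = 5 + card B + card C"
    using V disj fin cardA by (simp add: card_Un_disjoint Int_Un_distrib2)
  have pos: "k > 0" "l > 0"
    using colourable_iff_chromatic_number[OF pg, of 0] colourable_iff_chromatic_number[OF ph, of 0]
      V VH cardA by (auto simp: k_def l_def colourable_def)
  have nG: "\<not> colourable (parcs G) (A \<union> B) (k - 1)"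
    unfolding k_def
  proof (rule colourable_low_degree[OF pg, of C])
    show "int (out_degree (with_proj G) v) < int (chromatic_number G) - 1" if "v \<in> C" for v
      using that by (simp add: ABC C_part_def)
  qed (use V pos(1) in \<open>auto simp: k_def\<close>)
  \<comment> \<open>In the complement \<open>B\<close> is the low-degree part: a degree above
    \<open>k - 1\<close> in \<open>G\<close> becomes one below
    \<open>card (pverts G) - k = l - 1\<close>.\<close>
  have nH: "\<not> colourable (parcs H) (A \<union> C) (l - 1)"
    unfolding l_def
  proof (rule colourable_low_degree[OF ph, of B])
    fix v assume "v \<in> B"
    then have "v \<in> pverts G" "int (out_degree (with_proj G) v) > int k - 1"
      by (simp_all add: ABC B_part_def k_def)
    then show "int (out_degree (with_proj H) v) < int (chromatic_number H) - 1"
      using out_degree_complement[OF pg, of v] kl unfolding H_def[symmetric] l_def[symmetric]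
      by linarith
  qed (use VH pos(2) in \<open>auto simp: l_def\<close>)
  have "colourable (parcs G) (A \<union> B) (3 + card B)" "colourable (parcs H) (A \<union> C) (3 + card C)"
    using G H fin by (intro colourable_Un C5_colourable colourable_card ind indH pg ph; auto)+
  \<comment> \<open>This gives \<open>k \<le> card B + 3\<close> and
    \<open>l \<le> card C + 3\<close>. The right-hand sides sum to one more than the number of
    vertices, which is \<open>k + l\<close>, so both bounds are attained.\<close>
  with nG nH have "\<not> 3 + card B \<le> k - 1" "\<not> 3 + card C \<le> l - 1"
    using colourable_mono by blast+
  with card kl pos have k: "k = card B + 3" and l: "l = card C + 3"
    by auto
  have clique: "(x, y) \<in> parcs G" if xy: "x \<in> B" "y \<in> B" "x \<noteq> y" for x y
  proof (rule ccontr)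
    assume "(x, y) \<notin> parcs G"
    then have "colourable (parcs G) (A \<union> B) (3 + (card B - 1))"
      using G fin xy
      by (intro colourable_Un C5_colourable colourable_non_clique[of _ _ x y] ind pg) auto
    moreover have "card B > 0"
      using fin xy by (auto simp: card_gt_0_iff)
    ultimately show False
      using nG k by simp
  qed
  have stable: "(x, y) \<notin> parcs G" if xy: "x \<in> C" "y \<in> C" for x y
  proof
    assume "(x, y) \<in> parcs G"
    then have "x \<noteq> y" "(x, y) \<notin> parcs H" "(y, x) \<notin> parcs H"
      using G by (auto simp: H_def complement_iff)
    then have "colourable (parcs H) (A \<union> C) (3 + (card C - 1))"
      using H fin xy
      by (intro colourable_Un C5_colourable colourable_non_clique[of _ _ x y] indH ph) auto
    moreover have "card C > 0"
      using fin xy by (auto simp: card_gt_0_iff)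
    ultimately show False
      using nH l by simp
  qed
  have AB: "(a, b) \<in> parcs G" if ab: "a \<in> A" "b \<in> B" for a b
  proof (rule ccontr)
    assume "(a, b) \<notin> parcs G"
    \<comment> \<open>One colour for \<open>a\<close> and \<open>b\<close>, two for the rest of the
      cycle and one for each other vertex of \<open>B\<close>: in total
      \<open>card B + 2 = k - 1\<close>.\<close>
    then have "colourable (parcs G) ({a, b} \<union> (A - {a} \<union> (B - {b}))) (1 + (2 + card (B - {b})))"
      using G fin
      by (intro colourable_Un C5_colourable_minus colourable_nonadjacent colourable_card ind ab pg) auto
    moreover have "{a, b} \<union> (A - {a} \<union> (B - {b})) = A \<union> B"
      using ab by auto
    moreover have "card B > 0" "card (B - {b}) = card B - 1"
      using fin ab by (auto simp: card_gt_0_iff)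
    ultimately show False
      using nG k by simp
  qed
  have AC: "(a, c) \<notin> parcs G" if ac: "a \<in> A" "c \<in> C" for a c
  proof
    assume "(a, c) \<in> parcs G"
    \<comment> \<open>The degree \<open>k - 1 = card B + 2\<close> of \<open>a\<close> is already
      used up by its two neighbours on the cycle and by \<open>B\<close>, so \<open>c\<close> would
      be one too many.\<close>
    then have "insert c ({w \<in> A. (a, w) \<in> parcs G} \<union> B) \<subseteq> {w. (a, w) \<in> parcs G}" (is "?M \<subseteq> ?N")
      using AB ac by auto
    moreover have "finite ?N"
      by (rule finite_subset[OF _ G(1)]) (auto dest: G(3))
    ultimately have "card ?M \<le> card ?N"
      by (rule card_mono[rotated])
    moreover have "card ({w \<in> A. (a, w) \<in> parcs G} \<union> B) = 2 + card B"
      using C5_card_neighbours[OF ind ac(1) pg] disj(1) fin by (subst card_Un_disjoint) auto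
    moreover have "c \<notin> {w \<in> A. (a, w) \<in> parcs G} \<union> B"
      using disj ac by auto
    moreover have "card ?N = card B + 2"
      using ac(1) k by (simp add: ABC(1) A_part_def out_degree_eq_card k_def[symmetric])
    ultimately show False
      using fin by simp
  qed
  have "split_extension (cycle_graph 5) G A B C"
    unfolding split_extension_def is_clique_def is_stable_def
    using pg V disj ind clique stable AB AC by auto
  then show ?thesis
    by (simp add: ABC)
qed


section \<open>Unbalanced split graphs\<close>

definition single_vertex_graph :: "nat pair_pre_digraph" where
  "single_vertex_graph = \<lparr>pverts = {0}, parcs = {}\<rparr>"

lemma induces_single_vertex_iff:
  assumes "pair_graph G"
  shows "induces single_vertex_graph G A \<longleftrightarrow> (\<exists>v. A = {v})"
proof
  assume "induces single_vertex_graph G A"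
  then show "\<exists>v. A = {v}"
    by (auto simp: induces_def single_vertex_graph_def bij_betw_def)
next
  assume "\<exists>v. A = {v}"
  then obtain v where "A = {v}" ..
  then show "induces single_vertex_graph G A"
    using pair_graphD(5)[OF assms]
    by (auto simp: induces_def single_vertex_graph_def bij_betw_def intro!: exI[of _ "\<lambda>_. v"])
qed

text \<open>The choice of the vertex \<open>v\<close> determines everything: \<open>B\<close> must
  be its neighbourhood and \<open>C\<close> the rest.\<close>

lemma split_extension_single_vertex_iff:
  "split_extension single_vertex_graph G A B C \<longleftrightarrow> pair_graph G \<and>
     (\<exists>v\<in>pverts G. A = {v} \<and> B = {x. (v, x) \<in> parcs G} \<and>
        C = {x \<in> pverts G. x \<noteq> v \<and> (v, x) \<notin> parcs G} \<and> is_clique G B \<and> is_stable G C)"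
  (is "?L \<longleftrightarrow> ?R")
proof
  assume L: ?L
  then obtain v where v: "A = {v}" and pg: "pair_graph G"
    by (auto simp: split_extension_def induces_single_vertex_iff)
  note G = pair_graphD[OF pg]
  have V: "pverts G = insert v (B \<union> C)" and disj: "v \<notin> B" "v \<notin> C" "B \<inter> C = {}"
    and adj: "\<And>b. b \<in> B \<Longrightarrow> (v, b) \<in> parcs G" "\<And>c. c \<in> C \<Longrightarrow> (v, c) \<notin> parcs G"
    and cs: "is_clique G B" "is_stable G C"
    using L by (auto simp: v split_extension_def)
  have "x \<in> B \<longleftrightarrow> (v, x) \<in> parcs G" for x
    using adj G(3)[of v x] G(5)[of v] unfolding V by auto
  moreover from this have "x \<in> C \<longleftrightarrow> x \<in> pverts G \<and> x \<noteq> v \<and> (v, x) \<notin> parcs G" for x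
    using disj unfolding V by auto
  ultimately have "B = {x. (v, x) \<in> parcs G}" "C = {x \<in> pverts G. x \<noteq> v \<and> (v, x) \<notin> parcs G}"
    by blast+
  with pg v V cs show ?R
    by (intro conjI bexI[of _ v]) auto
next
  assume ?R
  then obtain v where pg: "pair_graph G" and v: "v \<in> pverts G" "A = {v}"
    and B: "B = {x. (v, x) \<in> parcs G}" and C: "C = {x \<in> pverts G. x \<noteq> v \<and> (v, x) \<notin> parcs G}"
    and cs: "is_clique G B" "is_stable G C"
    by auto
  have "pverts G = {v} \<union> B \<union> C" "{v} \<inter> B = {}" "{v} \<inter> C = {}" "B \<inter> C = {}"
    using v pair_graphD(3,5)[OF pg] by (auto simp: B C)
  moreover have "(v, b) \<in> parcs G" if "b \<in> B" for b
    using that by (simp add: B)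
  moreover have "(v, c) \<notin> parcs G" if "c \<in> C" for c
    using that by (simp add: C)
  moreover have "induces single_vertex_graph G {v}"
    by (simp add: induces_single_vertex_iff[OF pg])
  ultimately show ?L
    unfolding split_extension_def v(2) using pg cs by simp
qed

section \<open>Clique and independence numbers of split graphs\<close>

lemma finite_cards:
  assumes "finite V" "\<And>K. P K \<Longrightarrow> K \<subseteq> V"
  shows "finite {card K | K. P K}"
proof (rule finite_subset)
  show "{card K | K. P K} \<subseteq> card ` Pow V"
    using assms(2) by blast
qed (use assms(1) in simp)

lemma is_clique_card_le:
  assumes "finite (pverts G)" "is_clique G K"
  shows "card K \<le> clique_number G"
proof -
  have "finite {card K | K. is_clique G K}"
    using assms(1) by (rule finite_cards) (simp add: is_clique_def)
  then show ?thesis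
    unfolding clique_number_def using assms(2) by (intro Max_ge) blast+
qed

lemma obtain_max_clique:
  assumes "finite (pverts G)"
  obtains K where "is_clique G K" "card K = clique_number G"
proof -
  have "finite {card K | K. is_clique G K}"
    using assms(1) by (rule finite_cards) (simp add: is_clique_def)
  moreover have "is_clique G {}"
    by (simp add: is_clique_def)
  then have "{card K | K. is_clique G K} \<noteq> {}"
    by blast
  ultimately have "clique_number G \<in> {card K | K. is_clique G K}"
    unfolding clique_number_def by (rule Max_in)
  then obtain K where "clique_number G = card K" "is_clique G K"
    by blast
  then show thesis
    by (intro that) simp_all
qed

lemma is_stable_card_le:
  assumes "finite (pverts G)" "is_stable G S"
  shows "card S \<le> independence_number G"
proof -
  have "finite {card S | S. is_stable G S}"
    using assms(1) by (rule finite_cards) (simp add: is_stable_def)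
  then show ?thesis
    unfolding independence_number_def using assms(2) by (intro Max_ge) blast+
qed

lemma obtain_max_stable:
  assumes "finite (pverts G)"
  obtains S where "is_stable G S" "card S = independence_number G"
proof -
  have "finite {card S | S. is_stable G S}"
    using assms(1) by (rule finite_cards) (simp add: is_stable_def)
  moreover have "is_stable G {}"
    by (simp add: is_stable_def)
  then have "{card S | S. is_stable G S} \<noteq> {}"
    by blast
  ultimately have "independence_number G \<in> {card S | S. is_stable G S}"
    unfolding independence_number_def by (rule Max_in)
  then obtain S where "independence_number G = card S" "is_stable G S"
    by blast
  then show thesis
    by (intro that) simp_all
qed

lemma clique_inter_stable:
  assumes "is_clique G K" "is_stable G S"
  shows "card (K \<inter> S) \<le> 1"
proof (cases "K \<inter> S = {}")
  case False
  then obtain x where "x \<in> K \<inter> S" by blast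
  with assms have "K \<inter> S \<subseteq> {x}"
    unfolding is_clique_def is_stable_def by blast
  then show ?thesis
    using card_mono[of "{x}" "K \<inter> S"] by simp
qed simp

text \<open>With at most one element in \<open>Y\<close>, the set \<open>Q\<close> can exceed
  \<open>X\<close> in size only by containing all of it. Applied to a maximum clique against
  \<open>K\<close> and to a maximum stable set against \<open>S\<close>.\<close>

lemma larger_set_eq_insert:
  assumes "finite X" "finite Y" "Q \<subseteq> X \<union> Y" "X \<inter> Y = {}" "card X < card Q" "card (Q \<inter> Y) \<le> 1"
  obtains y where "y \<in> Y" "Q = insert y X"
proof -
  have Q: "Q = (Q \<inter> X) \<union> (Q \<inter> Y)"
    using assms(3) by blast
  have "card Q = card (Q \<inter> X) + card (Q \<inter> Y)"
    by (subst Q, subst card_Un_disjoint) (use assms in auto)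
  moreover have "card (Q \<inter> X) \<le> card X"
    using assms(1) by (intro card_mono) auto
  ultimately have "card (Q \<inter> X) = card X" "card (Q \<inter> Y) = 1"
    using assms(5,6) by linarith+
  then have "Q \<inter> X = X" "\<exists>y. Q \<inter> Y = {y}"
    using card_subset_eq[OF assms(1), of "Q \<inter> X"] by (auto simp: card_1_singleton_iff)
  then show thesis
    using that Q by auto
qed

text \<open>The extra vertex is one that can be moved between the clique and the stable set of a
  split partition.\<close>

lemma unbalanced_split_graph_iff:
  "G \<in> unbalanced_split_graphs \<longleftrightarrow> (\<exists>A B C. split_extension single_vertex_graph G A B C)"
proof
  assume "G \<in> unbalanced_split_graphs"
  then obtain K S where KS: "split_partition G K S" and pg: "pair_graph G"
    and neq: "\<not> (card K = clique_number G \<and> card S = independence_number G)"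
    by (auto simp: unbalanced_split_graphs_def split_graph_def balanced_split_graph_def)
  note G = pair_graphD[OF pg]
  have K: "is_clique G K" and S: "is_stable G S" and V: "pverts G = K \<union> S" and disj: "K \<inter> S = {}"
    using KS by (auto simp: split_partition_def)
  have fin: "finite K" "finite S"
    using G(1) V by auto
  have "card K \<le> clique_number G" "card S \<le> independence_number G"
    using is_clique_card_le is_stable_card_le G(1) K S by blast+
  then consider "card K < clique_number G" | "card S < independence_number G"
    using neq by linarith
  then show "\<exists>A B C. split_extension single_vertex_graph G A B C"
  proof cases
    case 1
    obtain Q where Q: "is_clique G Q" "card Q = clique_number G"
      using obtain_max_clique[OF G(1)] .
    obtain s where s: "s \<in> S" "Q = insert s K"
      by (rule larger_set_eq_insert[of K S Q])
        (use fin disj 1 Q V clique_inter_stable[OF Q(1) S] in \<open>auto simp: is_clique_def\<close>)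
    \<comment> \<open>Membership in the clique \<open>Q\<close> joins \<open>s\<close> to all of
      \<open>K\<close>, and membership in \<open>S\<close> separates it from the rest of
      \<open>S\<close>.\<close>
    have "split_extension single_vertex_graph G {s} K (S - {s})"
      unfolding split_extension_def induces_single_vertex_iff[OF pg] is_clique_def is_stable_def
      using pg V disj K S Q s by (auto simp: is_clique_def is_stable_def)
    then show ?thesis by blast
  next
    case 2
    obtain T where T: "is_stable G T" "card T = independence_number G"
      using obtain_max_stable[OF G(1)] .
    obtain k where k: "k \<in> K" "T = insert k S"
      by (rule larger_set_eq_insert[of S K T])
        (use fin disj 2 T V clique_inter_stable[OF K T(1)] in \<open>auto simp: is_stable_def Int_commute\<close>)
    have "split_extension single_vertex_graph G {k} (K - {k}) S"
      unfolding split_extension_def induces_single_vertex_iff[OF pg] is_clique_def is_stable_def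
      using pg V disj K S T k by (auto simp: is_clique_def is_stable_def)
    then show ?thesis by blast
  qed
next
  assume "\<exists>A B C. split_extension single_vertex_graph G A B C"
  then obtain v B C where ext: "split_extension single_vertex_graph G {v} B C" and pg: "pair_graph G"
    by (auto simp: split_extension_single_vertex_iff)
  note G = pair_graphD[OF pg]
  note fin = split_extension_finite[OF ext]
  have V: "pverts G = {v} \<union> B \<union> C" and disj: "v \<notin> B" "v \<notin> C" "B \<inter> C = {}"
    and BC: "is_clique G B" "is_stable G C"
    and adj: "\<And>b. b \<in> B \<Longrightarrow> (v, b) \<in> parcs G" "\<And>c. c \<in> C \<Longrightarrow> (v, c) \<notin> parcs G"
    using ext by (auto simp: split_extension_def)
  have clique: "is_clique G (insert v B)"
    using BC(1) V adj(1) G(4) by (auto simp: is_clique_def)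
  have stable: "is_stable G (insert v C)"
    using BC(2) V adj(2) G(4,5) by (auto simp: is_stable_def)
  have "split_partition G (insert v B) C"
    using clique BC V disj by (auto simp: split_partition_def)
  \<comment> \<open>The vertex \<open>v\<close> enlarges both \<open>B\<close> to a clique and
    \<open>C\<close> to a stable set. It is counted twice on the right, while every split partition
    counts each vertex once.\<close>
  moreover have "card K + card S < clique_number G + independence_number G"
    if "split_partition G K S" for K S
  proof -
    have "card (pverts G) = card K + card S"
      using that G(1) unfolding split_partition_def by (metis card_Un_disjoint finite_Un)
    moreover have "card (pverts G) = 1 + card B + card C"
      using split_extension_card[OF ext] by (simp add: single_vertex_graph_def)
    moreover have "card B + 1 \<le> clique_number G" "card C + 1 \<le> independence_number G"
      using is_clique_card_le[OF G(1) clique] is_stable_card_le[OF G(1) stable] fin disj by simp_all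
    ultimately show ?thesis by linarith
  qed
  ultimately show "G \<in> unbalanced_split_graphs"
    using pg unfolding unbalanced_split_graphs_def balanced_split_graph_def split_graph_def
    by fastforce
qed


section \<open>Isomorphism of the split part\<close>

text \<open>Isomorphism of the bipartite graphs between \<open>B\<close> and \<open>C\<close> that
  keeps the sides apart. Edges inside a side are ignored, as they are forced in a
  \<open>split_extension\<close>.\<close>

definition core_iso :: "'a pair_pre_digraph \<Rightarrow> 'a set \<Rightarrow> 'a set \<Rightarrow>
    'b pair_pre_digraph \<Rightarrow> 'b set \<Rightarrow> 'b set \<Rightarrow> bool" where
  "core_iso G B C G' B' C' \<longleftrightarrow> (\<exists>f. bij_betw f B B' \<and> bij_betw f C C' \<and>
     (\<forall>b\<in>B. \<forall>c\<in>C. (f b, f c) \<in> parcs G' \<longleftrightarrow> (b, c) \<in> parcs G))"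

lemma core_iso_refl: "core_iso G B C G B C"
  unfolding core_iso_def by (rule exI[of _ id]) auto

lemma core_iso_trans:
  assumes "core_iso G B C G' B' C'" "core_iso G' B' C' G'' B'' C''"
  shows "core_iso G B C G'' B'' C''"
proof -
  obtain f g where f: "bij_betw f B B'" "bij_betw f C C'"
      "\<forall>b\<in>B. \<forall>c\<in>C. (f b, f c) \<in> parcs G' \<longleftrightarrow> (b, c) \<in> parcs G"
    and g: "bij_betw g B' B''" "bij_betw g C' C''"
      "\<forall>b\<in>B'. \<forall>c\<in>C'. (g b, g c) \<in> parcs G'' \<longleftrightarrow> (b, c) \<in> parcs G'"
    using assms unfolding core_iso_def by blast
  have "bij_betw (g \<circ> f) B B''" "bij_betw (g \<circ> f) C C''"
    using f(1,2) g(1,2) by (auto intro: bij_betw_trans)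
  moreover have "((g \<circ> f) b, (g \<circ> f) c) \<in> parcs G'' \<longleftrightarrow> (b, c) \<in> parcs G"
    if "b \<in> B" "c \<in> C" for b c
    using that f(3) g(3) bij_betwE[OF f(1)] bij_betwE[OF f(2)] by simp
  ultimately show ?thesis
    unfolding core_iso_def by blast
qed

text \<open>Disjointness of the target sides makes \<open>f\<close> injective on the union of
  \<open>B\<close> and \<open>C\<close>, so that a single inverse serves both sides.\<close>

lemma core_iso_sym:
  assumes "core_iso G B C G' B' C'" "B \<inter> C = {}" "B' \<inter> C' = {}"
  shows "core_iso G' B' C' G B C"
proof -
  obtain f where f: "bij_betw f B B'" "bij_betw f C C'"
      "\<forall>b\<in>B. \<forall>c\<in>C. (f b, f c) \<in> parcs G' \<longleftrightarrow> (b, c) \<in> parcs G"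
    using assms unfolding core_iso_def by blast
  let ?g = "inv_into (B \<union> C) f"
  have bij: "bij_betw f (B \<union> C) (B' \<union> C')"
    using f(1,2) assms(3) by (rule bij_betw_combine)
  have "bij_betw ?g B' B" "bij_betw ?g C' C"
    using bij_betw_inv_into_subset[OF bij] f(1,2) by (auto simp: bij_betw_def)
  moreover have "(?g b, ?g c) \<in> parcs G \<longleftrightarrow> (b, c) \<in> parcs G'" if "b \<in> B'" "c \<in> C'" for b c
    using f(3) that bij_betwE[OF calculation(1)] bij_betwE[OF calculation(2)]
      bij_betw_inv_into_right[OF bij] by (metis UnCI)
  ultimately show ?thesis
    unfolding core_iso_def by blast
qed

text \<open>The isomorphism of the cores is extended by matching the two copies of \<open>P\<close>;
  all other adjacencies are forced by the definition.\<close>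

lemma split_extension_iso:
  assumes ext: "split_extension P G A B C" and ext': "split_extension P G' A' B' C'"
    and core: "core_iso G B C G' B' C'"
  shows "induces G G' (pverts G')"
proof -
  obtain f where f: "bij_betw f B B'" "bij_betw f C C'"
      "\<And>b c. b \<in> B \<Longrightarrow> c \<in> C \<Longrightarrow> (f b, f c) \<in> parcs G' \<longleftrightarrow> (b, c) \<in> parcs G"
    using core unfolding core_iso_def by blast
  have ind: "induces P G A" "induces P G' A'"
    using ext ext' by (simp_all add: split_extension_def)
  obtain g where g: "bij_betw g (pverts P) A"
      "\<And>i j. i \<in> pverts P \<Longrightarrow> j \<in> pverts P \<Longrightarrow> (g i, g j) \<in> parcs G \<longleftrightarrow> (i, j) \<in> parcs P"
    using ind(1) unfolding induces_def by blast
  obtain g' where g': "bij_betw g' (pverts P) A'"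
      "\<And>i j. i \<in> pverts P \<Longrightarrow> j \<in> pverts P \<Longrightarrow> (g' i, g' j) \<in> parcs G' \<longleftrightarrow> (i, j) \<in> parcs P"
    using ind(2) unfolding induces_def by blast
  \<comment> \<open>The map goes from the copy \<open>A\<close> back to the pattern \<open>P\<close>
    and on to the copy \<open>A'\<close>.\<close>
  define p where "p = g' \<circ> inv_into (pverts P) g"
  have p: "bij_betw p A A'"
    unfolding p_def using bij_betw_inv_into[OF g(1)] g'(1) by (rule bij_betw_trans)
  have pE: "(p u, p v) \<in> parcs G' \<longleftrightarrow> (u, v) \<in> parcs G" if "u \<in> A" "v \<in> A" for u v
    using g(2) g'(2) that bij_betwE[OF bij_betw_inv_into[OF g(1)]] bij_betw_inv_into_right[OF g(1)]
    unfolding p_def o_def by metis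
  define h where "h = (\<lambda>v. if v \<in> A then p v else f v)"
  have disj: "A \<inter> B = {}" "A \<inter> C = {}" "A' \<inter> B' = {}" "A' \<inter> C' = {}" "B' \<inter> C' = {}"
    and V: "pverts G = A \<union> B \<union> C" and V': "pverts G' = A' \<union> B' \<union> C'"
    and pg: "pair_graph G" and pg': "pair_graph G'"
    using ext ext' by (auto simp: split_extension_def)
  have hA: "h v = p v" if "v \<in> A" for v
    using that by (simp add: h_def)
  have hBC: "h v = f v" if "v \<in> B \<union> C" for v
    using that disj by (auto simp: h_def)
  have bij: "bij_betw h A A'" "bij_betw h B B'" "bij_betw h C C'"
    using p f(1,2) hA hBC by (auto cong: bij_betw_cong)
  then have "bij_betw h (pverts G) (pverts G')"
    unfolding V V' using disj by (intro bij_betw_combine) auto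
  moreover have "(h u, h v) \<in> parcs G' \<longleftrightarrow> (u, v) \<in> parcs G"
    if "u \<in> pverts G" "v \<in> pverts G" for u v
  proof -
    have mem: "h x \<in> A'" if "x \<in> A" for x using bij(1) that by (rule bij_betw_apply)
    have memB: "h x \<in> B'" if "x \<in> B" for x using bij(2) that by (rule bij_betw_apply)
    have memC: "h x \<in> C'" if "x \<in> C" for x using bij(3) that by (rule bij_betw_apply)
    have sym: "(x, y) \<in> parcs G \<longleftrightarrow> (y, x) \<in> parcs G" "(x', y') \<in> parcs G' \<longleftrightarrow> (y', x') \<in> parcs G'"
      for x y x' y'
      using pair_graphD(4)[OF pg] pair_graphD(4)[OF pg'] by blast+
    have AA: "(h x, h y) \<in> parcs G' \<longleftrightarrow> (x, y) \<in> parcs G" if "x \<in> A" "y \<in> A" for x y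
      using that pE hA by simp
    have AB: "(h x, h y) \<in> parcs G' \<longleftrightarrow> (x, y) \<in> parcs G" if "x \<in> A" "y \<in> B" for x y
      using that ext ext' mem memB by (auto simp: split_extension_def)
    have AC: "(h x, h y) \<in> parcs G' \<longleftrightarrow> (x, y) \<in> parcs G" if "x \<in> A" "y \<in> C" for x y
      using that ext ext' mem memC by (auto simp: split_extension_def)
    have BB: "(h x, h y) \<in> parcs G' \<longleftrightarrow> (x, y) \<in> parcs G" if "x \<in> B" "y \<in> B" for x y
    proof -
      have "h x = h y \<longleftrightarrow> x = y"
        using bij(2) that by (auto simp: bij_betw_def inj_on_eq_iff)
      then show ?thesis
        using that ext ext' memB pair_graphD(5)[OF pg] pair_graphD(5)[OF pg']
        unfolding split_extension_def is_clique_def by metis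
    qed
    have BC: "(h x, h y) \<in> parcs G' \<longleftrightarrow> (x, y) \<in> parcs G" if "x \<in> B" "y \<in> C" for x y
      using that f(3) hBC by simp
    have CC: "(h x, h y) \<in> parcs G' \<longleftrightarrow> (x, y) \<in> parcs G" if "x \<in> C" "y \<in> C" for x y
      using that ext ext' memC by (auto simp: split_extension_def is_stable_def)
    from that show ?thesis
      unfolding V using AA AB AC BB BC CC sym by (metis UnE)
  qed
  ultimately show ?thesis
    unfolding induces_def by blast
qed

text \<open>A decomposition is carried along an isomorphism by taking images, and the restricted
  isomorphism relates the cores.\<close>

lemma split_extension_image:
  assumes ext: "split_extension P G A B C" and pg': "pair_graph G'"
    and iso: "induces G G' (pverts G')"
  obtains A' B' C' where "split_extension P G' A' B' C'" "core_iso G B C G' B' C'"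
proof -
  obtain f where f: "bij_betw f (pverts G) (pverts G')"
    and E: "\<And>u v. u \<in> pverts G \<Longrightarrow> v \<in> pverts G \<Longrightarrow> (f u, f v) \<in> parcs G' \<longleftrightarrow> (u, v) \<in> parcs G"
    using iso unfolding induces_def by blast
  have V: "pverts G = A \<union> B \<union> C" and disj: "A \<inter> B = {}" "A \<inter> C = {}" "B \<inter> C = {}"
    using ext by (auto simp: split_extension_def)
  have inj: "inj_on f (pverts G)" and V': "pverts G' = f ` A \<union> f ` B \<union> f ` C"
    using f V by (auto simp: bij_betw_def)
  have "induces P G A"
    using ext by (simp add: split_extension_def)
  then obtain g where g: "bij_betw g (pverts P) A"
      "\<And>i j. i \<in> pverts P \<Longrightarrow> j \<in> pverts P \<Longrightarrow> (g i, g j) \<in> parcs G \<longleftrightarrow> (i, j) \<in> parcs P"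
    unfolding induces_def by blast
  have "bij_betw (f \<circ> g) (pverts P) (f ` A)"
    using g(1) inj V by (auto simp: bij_betw_def intro!: comp_inj_on elim: inj_on_subset)
  moreover have "((f \<circ> g) i, (f \<circ> g) j) \<in> parcs G' \<longleftrightarrow> (i, j) \<in> parcs P"
    if "i \<in> pverts P" "j \<in> pverts P" for i j
    using E g(2) that bij_betwE[OF g(1)] V by simp
  ultimately have ind: "induces P G' (f ` A)"
    unfolding induces_def by blast
  have "f ` A \<inter> f ` B = {}" "f ` A \<inter> f ` C = {}" "f ` B \<inter> f ` C = {}"
    using inj V disj by (auto simp: inj_on_eq_iff)
  then have "split_extension P G' (f ` A) (f ` B) (f ` C)"
    using ext pg' ind V' E V unfolding split_extension_def is_clique_def is_stable_def by auto
  moreover have "core_iso G B C G' (f ` B) (f ` C)"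
    unfolding core_iso_def
    using inj V E by (intro exI[of _ f]) (auto simp: bij_betw_def elim: inj_on_subset)
  ultimately show thesis
    using that by blast
qed

text \<open>Two candidates for the single vertex are twins, so exchanging them is an automorphism.\<close>

lemma core_iso_single_vertex:
  assumes ext: "split_extension single_vertex_graph G A B C"
    and ext': "split_extension single_vertex_graph G A' B' C'"
  shows "core_iso G B C G B' C'"
proof -
  obtain v w where pg: "pair_graph G" and v: "v \<in> pverts G" "B = {x. (v, x) \<in> parcs G}"
      "C = {x \<in> pverts G. x \<noteq> v \<and> (v, x) \<notin> parcs G}"
    and w: "w \<in> pverts G" "B' = {x. (w, x) \<in> parcs G}"
      "C' = {x \<in> pverts G. x \<noteq> w \<and> (w, x) \<notin> parcs G}"
    and cs: "is_clique G B" "is_stable G C" "is_clique G B'" "is_stable G C'"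
    using ext ext' unfolding split_extension_single_vertex_iff by blast
  note G = pair_graphD(2-5)[OF pg]
  have sym: "(x, y) \<in> parcs G \<longleftrightarrow> (y, x) \<in> parcs G" for x y
    using G(3) by blast
  have clique: "\<And>x y. (v, x) \<in> parcs G \<Longrightarrow> (v, y) \<in> parcs G \<Longrightarrow> x \<noteq> y \<Longrightarrow> (x, y) \<in> parcs G"
    "\<And>x y. (w, x) \<in> parcs G \<Longrightarrow> (w, y) \<in> parcs G \<Longrightarrow> x \<noteq> y \<Longrightarrow> (x, y) \<in> parcs G"
    using cs(1,3) unfolding is_clique_def v(2) w(2) by blast+
  have stable: "(x, y) \<notin> parcs G"
    if "S = {z \<in> pverts G. z \<noteq> u \<and> (u, z) \<notin> parcs G}" "is_stable G S"
      "x \<noteq> u" "y \<noteq> u" "(u, x) \<notin> parcs G" "(u, y) \<notin> parcs G" for S u x y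
  proof
    assume e: "(x, y) \<in> parcs G"
    then have "x \<in> S" "y \<in> S"
      using that G(1)[OF e] G(2)[OF e] by simp_all
    with e that(2) show False
      unfolding is_stable_def by blast
  qed
  \<comment> \<open>If \<open>v\<close> and \<open>w\<close> are adjacent, then \<open>w\<close>
    lies in the clique of neighbours of \<open>v\<close>, and so is adjacent to the other
    neighbours, and vice versa. If not, the same argument applies to the stable sets of
    non-neighbours.\<close>
  have twins: "(v, x) \<in> parcs G \<longleftrightarrow> (w, x) \<in> parcs G" if x: "x \<noteq> v" "x \<noteq> w" for x
  proof (cases "v = w")
    case False
    show ?thesis
    proof (cases "(v, w) \<in> parcs G")
      case True
      then show ?thesis
        using clique(1)[of w x] clique(2)[of v x] x sym[of v w] by auto
    next
      case nadj: False
      then show ?thesis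
        using stable[OF w(3) cs(4), of v x] stable[OF v(3) cs(2), of w x] x False sym[of v w] by auto
    qed
  qed simp
  then have twins': "(x, v) \<in> parcs G \<longleftrightarrow> (x, w) \<in> parcs G" if "x \<noteq> v" "x \<noteq> w" for x
    using that sym by blast
  \<comment> \<open>The transposition of \<open>v\<close> and \<open>w\<close>, or the identity if
    they coincide.\<close>
  define f where "f = (\<lambda>x. if x = w then v else if x = v then w else x)"
  have inv: "f (f x) = x" and fv: "f v = w" and mem: "f x \<in> pverts G \<longleftrightarrow> x \<in> pverts G"
    and f_eq: "f x = w \<longleftrightarrow> x = v" for x
    using v(1) w(1) by (auto simp: f_def)
  have fE: "(f x, f y) \<in> parcs G \<longleftrightarrow> (x, y) \<in> parcs G" for x y
  proof (cases "v = w")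
    case True
    then have "f z = z" for z
      by (simp add: f_def)
    then show ?thesis by simp
  next
    case False
    consider "x = v" | "x = w" | "x \<noteq> v" "x \<noteq> w"
      by blast
    then show ?thesis
      using sym[of v w] False
      by cases (cases "y = v"; cases "y = w"; simp add: f_def twins twins' G(4))+
  qed
  have image: "f ` X = Y" if "\<And>x. f x \<in> Y \<longleftrightarrow> x \<in> X" for X Y
  proof (intro equalityI subsetI)
    fix y assume "y \<in> Y"
    then show "y \<in> f ` X"
      using that[of "f y"] by (intro image_eqI[of _ _ "f y"]) (simp_all add: inv)
  qed (use that in auto)
  have "f x \<in> B' \<longleftrightarrow> x \<in> B" "f x \<in> C' \<longleftrightarrow> x \<in> C" for x
    using fE[of v x] mem[of x] f_eq[of x] by (simp_all add: v w fv)
  then have "f ` B = B'" "f ` C = C'"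
    by (simp_all add: image)
  moreover have "inj_on f X" for X
    by (rule inj_on_inverseI[of _ f]) (rule inv)
  ultimately show ?thesis
    unfolding core_iso_def bij_betw_def using fE by blast
qed

text \<open>The copy of \<open>P\<close> is replaced by a copy of \<open>Q\<close> while the core is
  kept. This turns a 5-cycle into a vertex and back.\<close>

lemma exists_split_extension:
  fixes G P Q :: "nat pair_pre_digraph"
  assumes ext: "split_extension P G A B C" and Q: "pair_graph Q"
  obtains G' A' where "split_extension Q G' A' B C" "core_iso G B C G' B C"
proof -
  \<comment> \<open>Shifting \<open>Q\<close> by a strict upper bound of the core makes its vertices
    fresh natural numbers.\<close>
  obtain m where m: "\<And>x. x \<in> B \<union> C \<Longrightarrow> x < m"
    using split_extension_finite[OF ext] by (metis finite_UnI finite_nat_set_iff_bounded)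
  have pg: "pair_graph G" and BC: "B \<subseteq> pverts G" "C \<subseteq> pverts G" "B \<inter> C = {}" "is_clique G B" "is_stable G C"
    using ext by (auto simp: split_extension_def)
  define A' where "A' = (+) m ` pverts Q"
  define G' where "G' = \<lparr>pverts = A' \<union> B \<union> C,
    parcs = {(u, v) \<in> parcs G. u \<in> B \<union> C \<and> v \<in> B \<union> C} \<union> (\<lambda>(i, j). (m + i, m + j)) ` parcs Q \<union>
      A' \<times> B \<union> B \<times> A'\<rparr>"
  have disj: "A' \<inter> B = {}" "A' \<inter> C = {}"
    using m by (fastforce simp: A'_def)+
  note Q' = pair_graphD[OF Q] and G = pair_graphD[OF pg]
  have core: "(u, v) \<in> parcs G' \<longleftrightarrow> (u, v) \<in> parcs G" if "u \<in> B \<union> C" "v \<in> B \<union> C" for u v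
    using that m[of u] disj by (auto simp: G'_def)
  have AA: "(m + i, m + j) \<in> parcs G' \<longleftrightarrow> (i, j) \<in> parcs Q" for i j
  proof -
    have "m + i \<notin> B \<union> C" "m + j \<notin> B \<union> C"
      using m[of "m + i"] m[of "m + j"] by auto
    then show ?thesis
      by (auto simp: G'_def)
  qed
  have AB: "(a, b) \<in> parcs G'" if "a \<in> A'" "b \<in> B" for a b
    using that by (auto simp: G'_def)
  have AC: "(a, c) \<notin> parcs G'" if "a \<in> A'" "c \<in> C" for a c
    using that disj BC(3) m[of c] by (auto simp: G'_def)
  have "pair_graph G'"
    unfolding pair_graph_iff
  proof (intro conjI allI)
    show "finite (pverts G')"
      using split_extension_finite[OF ext] Q'(1) by (simp add: G'_def A'_def)
    show "parcs G' \<subseteq> pverts G' \<times> pverts G'"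
      using Q'(2,3) by (auto simp: G'_def A'_def)
    show "sym (parcs G')"
      using Q'(4) G(4) by (fastforce simp: G'_def sym_def)
    show "(u, u) \<notin> parcs G'" for u
      using Q'(5) G(5) disj by (auto simp: G'_def)
  qed
  moreover have "induces Q G' A'"
    unfolding induces_def using AA
    by (intro exI[of _ "(+) m"]) (simp add: A'_def bij_betw_def)
  moreover have V': "pverts G' = A' \<union> B \<union> C"
    by (simp add: G'_def)
  moreover have "is_clique G' B" "is_stable G' C"
    using BC core V' unfolding is_clique_def is_stable_def by auto
  ultimately have "split_extension Q G' A' B C"
    unfolding split_extension_def using disj BC(3) AB AC by blast
  moreover have "core_iso G B C G' B C"
    unfolding core_iso_def using core by (intro exI[of _ id]) auto
  ultimately show thesis
    using that by blast
qed


section \<open>The bijection\<close>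

text \<open>A relation that is total on both sides, and under which equivalence on one side
  corresponds to equivalence on the other, induces a bijection of classes.\<close>

lemma bij_betw_quotients:
  assumes eq: "equiv S r" and "X \<subseteq> S" "Y \<subseteq> S"
    and total: "\<And>x. x \<in> X \<Longrightarrow> \<exists>y\<in>Y. R x y" "\<And>y. y \<in> Y \<Longrightarrow> \<exists>x\<in>X. R x y"
    and R: "\<And>x x' y y'. R x y \<Longrightarrow> R x' y' \<Longrightarrow> x \<in> X \<Longrightarrow> x' \<in> X \<Longrightarrow> y \<in> Y \<Longrightarrow> y' \<in> Y \<Longrightarrow>
      (x, x') \<in> r \<longleftrightarrow> (y, y') \<in> r"
  shows "\<exists>f. bij_betw f (X // r) (Y // r)"
proof -
  \<comment> \<open>Taking the union of the classes of all related elements avoids choosing a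
    representative; the next fact shows that it is one class.\<close>
  define F where "F Q = r `` {y \<in> Y. \<exists>x\<in>Q \<inter> X. R x y}" for Q
  have F: "F (r `` {x}) = r `` {y}" if "R x y" "x \<in> X" "y \<in> Y" for x y
  proof
    show "F (r `` {x}) \<subseteq> r `` {y}"
    proof
      fix z assume "z \<in> F (r `` {x})"
      then obtain x' y' where "(x, x') \<in> r" "x' \<in> X" "R x' y'" "y' \<in> Y" "(y', z) \<in> r"
        by (auto simp: F_def)
      then show "z \<in> r `` {y}"
        using R[of x y x' y'] that equivE[OF eq] by (auto dest: transD)
    qed
    have "x \<in> r `` {x}"
      using equiv_class_self[OF eq] that(2) assms(2) by blast
    then show "r `` {y} \<subseteq> F (r `` {x})"
      using that by (auto simp: F_def)
  qed
  have "inj_on F (X // r)"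
  proof (rule inj_onI)
    fix Q Q' assume Q: "Q \<in> X // r" "Q' \<in> X // r" and FQ: "F Q = F Q'"
    then obtain x x' where x: "x \<in> X" "Q = r `` {x}" "x' \<in> X" "Q' = r `` {x'}"
      by (auto elim!: quotientE)
    obtain y y' where y: "y \<in> Y" "R x y" "y' \<in> Y" "R x' y'"
      using total(1) x by blast
    then have "r `` {y} = r `` {y'}"
      using FQ F x by metis
    then have "(y, y') \<in> r"
      using eq y assms(3) by (meson eq_equiv_class subsetD)
    then have "(x, x') \<in> r"
      using R x y by blast
    then show "Q = Q'"
      using eq x by (simp add: equiv_class_eq)
  qed
  moreover have "F ` (X // r) = Y // r"
  proof (intro equalityI subsetI)
    fix Q assume "Q \<in> F ` (X // r)"
    then show "Q \<in> Y // r"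
      using total(1) F by (auto elim!: quotientE) (metis quotientI)
  next
    fix Q assume "Q \<in> Y // r"
    then obtain y where y: "y \<in> Y" "Q = r `` {y}"
      by (auto elim!: quotientE)
    then obtain x where "x \<in> X" "R x y"
      using total(2) by blast
    then show "Q \<in> F ` (X // r)"
      using F y by (metis image_eqI quotientI)
  qed
  ultimately show ?thesis
    unfolding bij_betw_def by blast
qed

lemma graph_iso_rel_iff:
  "(G, H) \<in> graph_iso_rel \<longleftrightarrow> pair_graph G \<and> pair_graph H \<and> induces G H (pverts H)"
proof -
  have "pair_graph G \<Longrightarrow> pair_graph H \<Longrightarrow>
      digraph_iso (with_proj G) (with_proj H) \<longleftrightarrow> induces G H (pverts H)"
    by (intro digraph_iso_iff_induces pair_digraph.pair_wf_digraph pair_graph.axioms(1))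
  then show ?thesis
    unfolding graph_iso_rel_def by blast
qed

text \<open>An isomorphism carries the decomposition of \<open>G\<close> to some decomposition of
  \<open>G'\<close>, and \<open>unique\<close> compares that one with the given one. The converse
  rebuilds the isomorphism from the core.\<close>

lemma graph_iso_rel_iff_core_iso:
  assumes "split_extension P G A B C" "split_extension P G' A' B' C'"
    and unique: "\<And>A'' B'' C''. split_extension P G' A'' B'' C'' \<Longrightarrow> core_iso G' B'' C'' G' B' C'"
  shows "(G, G') \<in> graph_iso_rel \<longleftrightarrow> core_iso G B C G' B' C'"
proof
  assume "(G, G') \<in> graph_iso_rel"
  then show "core_iso G B C G' B' C'"
    using split_extension_image[OF assms(1)] unique core_iso_trans
    unfolding graph_iso_rel_iff by metis
next
  assume "core_iso G B C G' B' C'"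
  then show "(G, G') \<in> graph_iso_rel"
    using split_extension_iso[OF assms(1,2)] assms(1,2)
    by (auto simp: graph_iso_rel_iff split_extension_def)
qed

theorem theorem4p4:
  fixes n :: nat
  assumes "n > 0"
  shows "\<exists>f. bij_betw f (unlabeled_of_order NG_3 (int n))
                     (unlabeled_of_order unbalanced_split_graphs (int n - 4))"
  unfolding unlabeled_of_order_def
proof (rule bij_betw_quotients[OF equiv_graph_iso_rel])
  \<comment> \<open>Graphs of the two classes are related when their cores are isomorphic.\<close>
  define R :: "nat pair_pre_digraph \<Rightarrow> nat pair_pre_digraph \<Rightarrow> bool" where
    "R G H \<longleftrightarrow> (\<exists>A B C A' B' C'. split_extension (cycle_graph 5) G A B C \<and>
       split_extension single_vertex_graph H A' B' C' \<and> core_iso G B C H B' C')" for G H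
  let ?X = "{G \<in> NG_3. int (card (pverts G)) = int n}"
  let ?Y = "{H \<in> unbalanced_split_graphs. int (card (pverts H)) = int n - 4}"
  have cycle: "pair_graph (cycle_graph 5)"
    unfolding pair_graph_iff
  proof (intro conjI allI)
    show "parcs (cycle_graph 5) \<subseteq> pverts (cycle_graph 5) \<times> pverts (cycle_graph 5)"
      by (auto simp: cycle_graph_def)
    show "sym (parcs (cycle_graph 5))"
      by (auto simp: sym_def cycle_graph_def)
    show "(u, u) \<notin> parcs (cycle_graph 5)" for u
      by (auto simp: parcs_C5)
  qed simp
  have single: "pair_graph single_vertex_graph"
    unfolding pair_graph_iff by (simp add: single_vertex_graph_def)
  \<comment> \<open>The cores have equal size, and 4 is the difference between the five vertices of
    the cycle and the single vertex.\<close>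
  have R_card: "card (pverts G) = card (pverts H) + 4" if RGH: "R G H" for G H
  proof -
    obtain A B C A' B' C' where "split_extension (cycle_graph 5) G A B C"
      "split_extension single_vertex_graph H A' B' C'" "core_iso G B C H B' C'"
      using RGH unfolding R_def by blast
    moreover from this have "card B = card B'" "card C = card C'"
      by (auto simp: core_iso_def dest: bij_betw_same_card)
    ultimately show ?thesis
      by (simp add: split_extension_card single_vertex_graph_def)
  qed
  show "?X \<subseteq> {G. pair_graph G}" "?Y \<subseteq> {G. pair_graph G}"
    by (auto simp: NG_3_def NG_graph_def unbalanced_split_graphs_def split_graph_def)
  show "\<exists>H\<in>?Y. R G H" if G: "G \<in> ?X" for G
  proof -
    have ext: "split_extension (cycle_graph 5) G (A_part G) (B_part G) (C_part G)"
      using G NG_3_split_extension by blast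
    obtain H A' where "split_extension single_vertex_graph H A' (B_part G) (C_part G)"
      "core_iso G (B_part G) (C_part G) H (B_part G) (C_part G)"
      using exists_split_extension[OF ext single] .
    with ext have "R G H" "H \<in> unbalanced_split_graphs"
      unfolding R_def unbalanced_split_graph_iff by blast+
    then show ?thesis
      using R_card[of G H] G by auto
  qed
  show "\<exists>G\<in>?X. R G H" if H: "H \<in> ?Y" for H
  proof -
    obtain A' B C where ext: "split_extension single_vertex_graph H A' B C"
      using H unbalanced_split_graph_iff by blast
    obtain G A where G: "split_extension (cycle_graph 5) G A B C" "core_iso H B C G B C"
      using exists_split_extension[OF ext cycle] .
    then have "core_iso G B C H B C"
      using ext by (intro core_iso_sym[OF G(2)]) (auto simp: split_extension_def)
    with ext G(1) have "R G H" "G \<in> NG_3"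
      unfolding R_def using split_extension_C5_NG_3 by blast+
    then show ?thesis
      using R_card[of G H] H by auto
  qed
  show "(G, G') \<in> graph_iso_rel \<longleftrightarrow> (H, H') \<in> graph_iso_rel" if RGH: "R G H" "R G' H'" for G G' H H'
  proof -
    obtain A B C a b c where GH: "split_extension (cycle_graph 5) G A B C"
      "split_extension single_vertex_graph H a b c" "core_iso G B C H b c"
      using RGH(1) unfolding R_def by blast
    obtain A' B' C' a' b' c' where GH': "split_extension (cycle_graph 5) G' A' B' C'"
      "split_extension single_vertex_graph H' a' b' c'" "core_iso G' B' C' H' b' c'"
      using RGH(2) unfolding R_def by blast
    have sym: "core_iso H b c G B C" "core_iso H' b' c' G' B' C'"
      using GH GH' by (auto intro!: core_iso_sym simp: split_extension_def)
    have "(G, G') \<in> graph_iso_rel \<longleftrightarrow> core_iso G B C G' B' C'"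
    proof (rule graph_iso_rel_iff_core_iso[OF GH(1) GH'(1)])
      \<comment> \<open>Here the decomposition is the ABC-partition and hence unique; for the split
        graphs below it is unique only up to exchanging twins.\<close>
      show "core_iso G' B'' C'' G' B' C'" if "split_extension (cycle_graph 5) G' A'' B'' C''" for A'' B'' C''
        using split_extension_C5_ABC[OF that] split_extension_C5_ABC[OF GH'(1)] core_iso_refl by metis
    qed
    also have "\<dots> \<longleftrightarrow> core_iso H b c H' b' c'"
      using GH(3) GH'(3) sym core_iso_trans by metis
    also have "\<dots> \<longleftrightarrow> (H, H') \<in> graph_iso_rel"
      using core_iso_single_vertex[OF _ GH'(2)]
      by (intro graph_iso_rel_iff_core_iso[OF GH(2) GH'(2), symmetric])
    finally show ?thesis .
  qed
qed

end
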